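(* Let $m\ge 2$. The pair $(\mathfrak{sl}(2m-1,\mathbb{R}),J_{\mathfrak q})$, where $J_{\mathfrak q}$ is the complex structure defined by the complex subalgebra $\mathfrak q\subset\mathfrak{sl}(2m-1,\mathbb{C})$ described in the context, does not admit compatible pluriclosed metrics.
   Context: Let $\mathfrak g_0=\mathfrak{sl}(2m-1,\mathbb{R})$, $\mathfrak g=\mathfrak{sl}(2m-1,\mathbb{C})$, and let $\sigma$ be the complex conjugation of $\mathfrak g$ with respect to $\mathfrak g_0$. Let $\mathfrak g_0=\mathfrak k_0\oplus\mathfrak p_0$ be a Cartan decomposition with Cartan involution $\theta$, and let $\mathfrak h_0=\mathfrak t_0\oplus\mathfrak a_0$ ($\mathfrak t_0\subset\mathfrak k_0$, $\mathfrak a_0\subset\mathfrak p_0$) be a maximally compact $\theta$-stable Cartan subalgebra of $\mathfrak g_0$, with complexification $\mathfrak h\subset\mathfrak g$. Let $\Sigma$ be the root system of $(\mathfrak g,\mathfrak h)$, with root spaces $\mathfrak g_\alpha$. The conjugation $\sigma$ acts on roots by $\sigma(\mathfrak g_\alpha)=\mathfrak g_{\sigma(\alpha)}$. Positive roots $\Sigma^+$ and simple roots $\Delta=\{\alpha_1,\dots,\alpha_{2m-2}\}$ (labelled so that the Cartan matrix is the standard one of type $A_{2m-2}$) are chosen using a lexicographic ordering with respect to an ordered basis formed by a basis of $i\mathfrak t_0$ followed by a basis of $\mathfrak a_0$; then $$\Sigma^+=\{\alpha_j^k=\alpha_j+\alpha_{j+1}+\dots+\alpha_{j+k-1}:\ 1\le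 k\le 2m-2,\ 1\le j\le 2m-1-k\},$$ $\theta(\alpha_j)=\alpha_{2m-1-j}$ and $\sigma(\alpha_j)=-\alpha_{2m-1-j}$ (hence $\sigma(\alpha_j^k)=-\alpha_{2m-k-j}^k$). Choose generators $e_\alpha$ of $\mathfrak g_\alpha$, $\alpha\in\Sigma^+$, such that $[e_\alpha,e_\beta]=e_{\alpha+\beta}$ whenever $\alpha,\beta,\alpha+\beta\in\Sigma^+$ and $\alpha<\beta$ in lexicographic order. For $\alpha\in\Sigma$ let $H_\alpha\in\mathfrak h$ be defined by $B(H,H_\alpha)=\alpha(H)$ for all $H\in\mathfrak h$, where $B$ is the Killing form of $\mathfrak g$, and put $H_j=H_{\alpha_j}$; thus $\sigma(H_j)=-H_{2m-1-j}$. Define $$\tilde H_k=H_k-2H_{2m-1-k}=H_k+2\sigma(H_k)\quad(1\le k\le m-3),$$ $$\tilde H_{m-2}=2H_{m-2}+H_{m-1}\ (\text{if } m\ge 3),\qquad \tilde H_{m-1}=H_{m-1}+2H_m=H_{m-1}-2\sigma(H_{m-1}),$$ $\tilde{\mathcal H}=\{\tilde H_k:1\le k\le m-1\}$, $\hat\Sigma^+=\Sigma^+\setminus\{\alpha_{m-1}\}$, and $e_0=e_{\alpha_{m-1}}+\sigma(e_{\alpha_m})$. Let $\mathfrak q$ be the complex span of $\tilde{\mathcal H}\cup\{e_\alpha:\alpha\in\hat\Sigma^+\}\cup\{e_0\}$. It is a complex subalgebra of $\mathfrak g$ with $\mathfrak g=\mathfrak q\oplus\sigma(\mathfrak q)$,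 and $J_{\mathfrak q}$ denotes the complex structure on $\mathfrak g_0$ whose $i$-eigenspace $\mathfrak g_0^{1,0}$ is $\mathfrak q$ and whose $(-i)$-eigenspace is $\sigma(\mathfrak q)$. A compatible metric on $(\mathfrak g_0,J)$ is a positive definite inner product $g$ on $\mathfrak g_0$ with $g(J\cdot,J\cdot)=g$ (equivalently a left-invariant Hermitian metric on a corresponding Lie group), with fundamental form $\omega$. It is pluriclosed if $\partial\bar\partial\omega=0$, where the Chevalley–Eilenberg differential is split as $d=\partial+\bar\partial$ according to $J$. *)

theory Defs
  imports "HOL-Analysis.Analysis"
begin

section \<open>Matrices as a vector space over their field of entries\<close>

text \<open>Square matrices are of type \<^typ>\<open>'a ^ 'n ^ 'n\<close>. The library only scales them by reals,
  so scaling by the entry field is provided here; for real matrices it coincides with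
  \<^term>\<open>scaleR\<close>.\<close>

definition mscale :: "'a::field \<Rightarrow> 'a ^ 'n ^ 'm \<Rightarrow> 'a ^ 'n ^ 'm" (infixr \<open>*\<^sub>m\<close> 75)
  where "c *\<^sub>m A = (\<chi> i j. c * A $ i $ j)"

global_interpretation msp: vector_space "mscale :: 'a::field \<Rightarrow> 'a ^ 'n ^ 'm \<Rightarrow> _"
  by unfold_locales (simp_all add: mscale_def vec_eq_iff algebra_simps)

definition mlinear_on :: "('a::field ^ 'n ^ 'n) set \<Rightarrow> ('a ^ 'n ^ 'n \<Rightarrow> 'a ^ 'n ^ 'n) \<Rightarrow> bool"
  where "mlinear_on V f \<longleftrightarrow>
    (\<forall>X\<in>V. \<forall>Y\<in>V. f (X + Y) = f X + f Y) \<and> (\<forall>c. \<forall>X\<in>V. f (c *\<^sub>m X) = c *\<^sub>m f X)"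

definition mfunctional_on :: "('a::field ^ 'n ^ 'n) set \<Rightarrow> ('a ^ 'n ^ 'n \<Rightarrow> 'a) \<Rightarrow> bool"
  where "mfunctional_on V \<phi> \<longleftrightarrow>
    (\<forall>X\<in>V. \<forall>Y\<in>V. \<phi> (X + Y) = \<phi> X + \<phi> Y) \<and> (\<forall>c. \<forall>X\<in>V. \<phi> (c *\<^sub>m X) = c * \<phi> X)"

text \<open>The trace of an endomorphism of a subspace \<open>V\<close>: the sum of the diagonal entries of its
  matrix with respect to a basis of \<open>V\<close>.\<close>

definition trace_on :: "('a::field ^ 'n ^ 'n) set \<Rightarrow> ('a ^ 'n ^ 'n \<Rightarrow> 'a ^ 'n ^ 'n) \<Rightarrow> 'a"
  where "trace_on V f =
    (let b = (SOME b. msp.independent b \<and> msp.span b = V)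
     in \<Sum>v\<in>b. msp.representation b (f v) v)"


section \<open>Special linear Lie algebras and the Killing form\<close>

definition bracket :: "'a::field ^ 'n ^ 'n \<Rightarrow> 'a ^ 'n ^ 'n \<Rightarrow> 'a ^ 'n ^ 'n"
  where "bracket X Y = X ** Y - Y ** X"

definition sl :: "('a::field ^ 'n ^ 'n) set"
  where "sl = {X. trace X = 0}"

definition killing :: "'a::field ^ 'n ^ 'n \<Rightarrow> 'a ^ 'n ^ 'n \<Rightarrow> 'a"
  where "killing X Y = trace_on sl (\<lambda>Z. bracket X (bracket Y Z))"

abbreviation sl_real :: "(real ^ 'n ^ 'n) set" where "sl_real \<equiv> sl"

abbreviation sl_complex :: "(complex ^ 'n ^ 'n) set" where "sl_complex \<equiv> sl"


section \<open>Complexification\<close>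

definition of_real_mat :: "real ^ 'n ^ 'n \<Rightarrow> complex ^ 'n ^ 'n"
  where "of_real_mat X = (\<chi> i j. complex_of_real (X $ i $ j))"

definition Re_mat :: "complex ^ 'n ^ 'n \<Rightarrow> real ^ 'n ^ 'n"
  where "Re_mat Z = (\<chi> i j. Re (Z $ i $ j))"

definition Im_mat :: "complex ^ 'n ^ 'n \<Rightarrow> real ^ 'n ^ 'n"
  where "Im_mat Z = (\<chi> i j. Im (Z $ i $ j))"

text \<open>The conjugation \<open>\<sigma>\<close> of \<open>sl(n,\<complex>)\<close> with respect to \<open>sl(n,\<real>)\<close>.\<close>

definition conj_mat :: "complex ^ 'n ^ 'n \<Rightarrow> complex ^ 'n ^ 'n"
  where "conj_mat Z = (\<chi> i j. cnj (Z $ i $ j))"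

definition complexify :: "(real ^ 'n ^ 'n) set \<Rightarrow> (complex ^ 'n ^ 'n) set"
  where "complexify V = {of_real_mat X + \<i> *\<^sub>m of_real_mat Y | X Y. X \<in> V \<and> Y \<in> V}"

text \<open>Complex linear extension of an endomorphism and complex bilinear extension of a bilinear
  form.\<close>

definition cext :: "(real ^ 'n ^ 'n \<Rightarrow> real ^ 'n ^ 'n) \<Rightarrow> complex ^ 'n ^ 'n \<Rightarrow> complex ^ 'n ^ 'n"
  where "cext f Z = of_real_mat (f (Re_mat Z)) + \<i> *\<^sub>m of_real_mat (f (Im_mat Z))"

definition cext2 ::
  "(real ^ 'n ^ 'n \<Rightarrow> real ^ 'n ^ 'n \<Rightarrow> real) \<Rightarrow> complex ^ 'n ^ 'n \<Rightarrow> complex ^ 'n ^ 'n \<Rightarrow> complex"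
  where "cext2 b Z W =
    complex_of_real (b (Re_mat Z) (Re_mat W) - b (Im_mat Z) (Im_mat W)) +
    \<i> * complex_of_real (b (Re_mat Z) (Im_mat W) + b (Im_mat Z) (Re_mat W))"


section \<open>Cartan involutions and Cartan subalgebras\<close>

definition cartan_involution :: "(real ^ 'n ^ 'n \<Rightarrow> real ^ 'n ^ 'n) \<Rightarrow> bool"
  where "cartan_involution \<theta> \<longleftrightarrow>
    mlinear_on sl \<theta> \<and> \<theta> ` sl \<subseteq> sl \<and>
    (\<forall>X\<in>sl. \<theta> (\<theta> X) = X) \<and>
    (\<forall>X\<in>sl. \<forall>Y\<in>sl. \<theta> (bracket X Y) = bracket (\<theta> X) (\<theta> Y)) \<and>
    (\<forall>X\<in>sl. X \<noteq> 0 \<longrightarrow> - killing X (\<theta> X) > 0)"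

definition k_part :: "(real ^ 'n ^ 'n \<Rightarrow> real ^ 'n ^ 'n) \<Rightarrow> (real ^ 'n ^ 'n) set"
  where "k_part \<theta> = {X \<in> sl. \<theta> X = X}"

definition p_part :: "(real ^ 'n ^ 'n \<Rightarrow> real ^ 'n ^ 'n) \<Rightarrow> (real ^ 'n ^ 'n) set"
  where "p_part \<theta> = {X \<in> sl. \<theta> X = - X}"

definition abelian_subalgebra :: "('a::field ^ 'n ^ 'n) set \<Rightarrow> bool"
  where "abelian_subalgebra \<a> \<longleftrightarrow>
    msp.subspace \<a> \<and> \<a> \<subseteq> sl \<and> (\<forall>X\<in>\<a>. \<forall>Y\<in>\<a>. bracket X Y = 0)"

text \<open>\<open>ad H\<close> is semisimple on \<open>sl(n,\<complex>)\<close>: its eigenvectors span.\<close>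

definition ad_semisimple :: "complex ^ 'n ^ 'n \<Rightarrow> bool"
  where "ad_semisimple H \<longleftrightarrow> msp.span {X \<in> sl. \<exists>c. bracket H X = c *\<^sub>m X} = sl"

text \<open>Cartan subalgebras of a complex semisimple Lie algebra are taken in the usual sense of a
  maximal abelian subalgebra consisting of ad-semisimple elements; those of a real form are the
  subalgebras whose complexification is one.\<close>

definition cartan_subalgebra :: "(complex ^ 'n ^ 'n) set \<Rightarrow> bool"
  where "cartan_subalgebra \<h> \<longleftrightarrow>
    abelian_subalgebra \<h> \<and>
    (\<forall>\<b>. abelian_subalgebra \<b> \<and> \<h> \<subseteq> \<b> \<longrightarrow> \<b> = \<h>) \<and>
    (\<forall>H\<in>\<h>. ad_semisimple H)"

definition real_cartan_subalgebra :: "(real ^ 'n ^ 'n) set \<Rightarrow> bool"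
  where "real_cartan_subalgebra \<h>\<^sub>0 \<longleftrightarrow>
    msp.subspace \<h>\<^sub>0 \<and> \<h>\<^sub>0 \<subseteq> sl \<and> (\<forall>X\<in>\<h>\<^sub>0. \<forall>Y\<in>\<h>\<^sub>0. bracket X Y \<in> \<h>\<^sub>0) \<and>
    cartan_subalgebra (complexify \<h>\<^sub>0)"

text \<open>A \<open>\<theta>\<close>-stable Cartan subalgebra is maximally compact if its compact dimension, the dimension
  of its intersection with the \<open>+1\<close>-eigenspace of \<open>\<theta>\<close>, is as large as possible.\<close>

definition maximally_compact ::
  "(real ^ 'n ^ 'n \<Rightarrow> real ^ 'n ^ 'n) \<Rightarrow> (real ^ 'n ^ 'n) set \<Rightarrow> bool"
  where "maximally_compact \<theta> \<h>\<^sub>0 \<longleftrightarrow>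
    real_cartan_subalgebra \<h>\<^sub>0 \<and> \<theta> ` \<h>\<^sub>0 \<subseteq> \<h>\<^sub>0 \<and>
    (\<forall>\<h>\<^sub>1. real_cartan_subalgebra \<h>\<^sub>1 \<and> \<theta> ` \<h>\<^sub>1 \<subseteq> \<h>\<^sub>1 \<longrightarrow>
       msp.dim (\<h>\<^sub>1 \<inter> k_part \<theta>) \<le> msp.dim (\<h>\<^sub>0 \<inter> k_part \<theta>))"

definition ordered_basis :: "(real ^ 'n ^ 'n) list \<Rightarrow> (real ^ 'n ^ 'n) set \<Rightarrow> bool"
  where "ordered_basis bs V \<longleftrightarrow>
    distinct bs \<and> msp.independent (set bs) \<and> msp.span (set bs) = V"


section \<open>Roots\<close>

text \<open>A functional on \<open>\<h>\<close> is represented by a function on all matrices that vanishes outside \<open>\<h>\<close>,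
  so that equality of functionals is equality of functions.\<close>

definition dual_space ::
  "(complex ^ 'n ^ 'n) set \<Rightarrow> (complex ^ 'n ^ 'n \<Rightarrow> complex) set"
  where "dual_space \<h> = {\<phi>. mfunctional_on \<h> \<phi> \<and> (\<forall>X. X \<notin> \<h> \<longrightarrow> \<phi> X = 0)}"

definition root_space ::
  "(complex ^ 'n ^ 'n) set \<Rightarrow> (complex ^ 'n ^ 'n \<Rightarrow> complex) \<Rightarrow> (complex ^ 'n ^ 'n) set"
  where "root_space \<h> \<phi> = {X \<in> sl. \<forall>H\<in>\<h>. bracket H X = \<phi> H *\<^sub>m X}"

definition roots :: "(complex ^ 'n ^ 'n) set \<Rightarrow> (complex ^ 'n ^ 'n \<Rightarrow> complex) set"
  where "roots \<h> = {\<phi> \<in> dual_space \<h>. \<phi> \<noteq> (\<lambda>X. 0) \<and> root_space \<h> \<phi> \<noteq> {0}}"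

definition root_add ::
  "(complex ^ 'n ^ 'n \<Rightarrow> complex) \<Rightarrow> (complex ^ 'n ^ 'n \<Rightarrow> complex) \<Rightarrow> (complex ^ 'n ^ 'n \<Rightarrow> complex)"
  where "root_add \<phi> \<psi> = (\<lambda>X. \<phi> X + \<psi> X)"

text \<open>The ordered basis of \<open>i\<t>\<^sub>0 \<oplus> \<a>\<^sub>0\<close> formed by \<open>i\<close> times a basis of \<open>\<t>\<^sub>0\<close>
  followed by a basis of \<open>\<a>\<^sub>0\<close>.\<close>

definition lex_basis :: "(real ^ 'n ^ 'n) list \<Rightarrow> (real ^ 'n ^ 'n) list \<Rightarrow> (complex ^ 'n ^ 'n) list"
  where "lex_basis ts ps = map (\<lambda>T. \<i> *\<^sub>m of_real_mat T) ts @ map of_real_mat ps"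

text \<open>Roots take real values on \<open>i\<t>\<^sub>0 \<oplus> \<a>\<^sub>0\<close>, so that \<^term>\<open>Re\<close> only changes the type.\<close>

definition lex_positive :: "(complex ^ 'n ^ 'n) list \<Rightarrow> (complex ^ 'n ^ 'n \<Rightarrow> complex) \<Rightarrow> bool"
  where "lex_positive Hs \<phi> \<longleftrightarrow>
    (\<exists>i<length Hs. (\<forall>j<i. \<phi> (Hs ! j) = 0) \<and> Re (\<phi> (Hs ! i)) > 0)"

definition pos_roots ::
  "(complex ^ 'n ^ 'n) set \<Rightarrow> (complex ^ 'n ^ 'n) list \<Rightarrow> (complex ^ 'n ^ 'n \<Rightarrow> complex) set"
  where "pos_roots \<h> Hs = {\<phi> \<in> roots \<h>. lex_positive Hs \<phi>}"

definition simple_roots ::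
  "(complex ^ 'n ^ 'n) set \<Rightarrow> (complex ^ 'n ^ 'n) list \<Rightarrow> (complex ^ 'n ^ 'n \<Rightarrow> complex) set"
  where "simple_roots \<h> Hs =
    {\<phi> \<in> pos_roots \<h> Hs.
       \<not> (\<exists>\<beta>\<in>pos_roots \<h> Hs. \<exists>\<gamma>\<in>pos_roots \<h> Hs. \<phi> = root_add \<beta> \<gamma>)}"

text \<open>The element \<open>H\<^sub>\<phi>\<close> of \<open>\<h>\<close> that represents \<open>\<phi>\<close> via the Killing form.\<close>

definition killing_dual ::
  "(complex ^ 'n ^ 'n) set \<Rightarrow> (complex ^ 'n ^ 'n \<Rightarrow> complex) \<Rightarrow> complex ^ 'n ^ 'n"
  where "killing_dual \<h> \<phi> = (THE K. K \<in> \<h> \<and> (\<forall>H\<in>\<h>. killing H K = \<phi> H))"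

definition root_inner ::
  "(complex ^ 'n ^ 'n) set \<Rightarrow> (complex ^ 'n ^ 'n \<Rightarrow> complex) \<Rightarrow> (complex ^ 'n ^ 'n \<Rightarrow> complex) \<Rightarrow> complex"
  where "root_inner \<h> \<phi> \<psi> = killing (killing_dual \<h> \<phi>) (killing_dual \<h> \<psi>)"

text \<open>\<open>\<alpha> 1, \<dots>, \<alpha> r\<close> enumerate the simple roots in such a way that the Cartan matrix is the standard
  one of type \<open>A\<^sub>r\<close>.\<close>

definition standard_labelling ::
  "(complex ^ 'n ^ 'n) set \<Rightarrow> (complex ^ 'n ^ 'n) list \<Rightarrow> nat \<Rightarrow>
   (nat \<Rightarrow> complex ^ 'n ^ 'n \<Rightarrow> complex) \<Rightarrow> bool"
  where "standard_labelling \<h> Hs r \<alpha> \<longleftrightarrow>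
    bij_betw \<alpha> {1..r} (simple_roots \<h> Hs) \<and>
    (\<forall>i\<in>{1..r}. \<forall>j\<in>{1..r}.
       2 * root_inner \<h> (\<alpha> i) (\<alpha> j) / root_inner \<h> (\<alpha> j) (\<alpha> j) =
         (if i = j then 2 else if i = Suc j \<or> j = Suc i then -1 else 0))"

text \<open>\<open>root_string \<alpha> j k\<close> is the root \<open>\<alpha>\<^sub>j + \<alpha>\<^sub>j\<^sub>+\<^sub>1 + \<dots> + \<alpha>\<^sub>j\<^sub>+\<^sub>k\<^sub>-\<^sub>1\<close>.\<close>

definition root_string ::
  "(nat \<Rightarrow> complex ^ 'n ^ 'n \<Rightarrow> complex) \<Rightarrow> nat \<Rightarrow> nat \<Rightarrow> complex ^ 'n ^ 'n \<Rightarrow> complex"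
  where "root_string \<alpha> j k = (\<lambda>X. \<Sum>i = j..<j + k. \<alpha> i X)"

text \<open>Generators of the positive root spaces, for \<open>n = 2m - 1\<close>, with \<open>[e\<^sub>\<beta>, e\<^sub>\<gamma>] = e\<^bsub>\<beta>+\<gamma>\<^esub>\<close> whenever
  \<open>\<beta>\<close>, \<open>\<gamma>\<close>, \<open>\<beta> + \<gamma>\<close> are positive and \<open>\<beta>\<close> precedes \<open>\<gamma>\<close>.
  The roots \<open>\<alpha>\<^sub>j\<^sup>k = root_string \<alpha> j k\<close> are compared by the lexicographic order of their labels
  \<open>(j, k)\<close>. The order of functionals given by \<^const>\<open>lex_positive\<close> is not usable here: for
  \<open>m \<ge> 3\<close> the Jacobi identity would exclude any such choice of generators.\<close>

definition root_generators ::
  "(complex ^ 'n ^ 'n) set \<Rightarrow> (complex ^ 'n ^ 'n) list \<Rightarrow> nat \<Rightarrow>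
   (nat \<Rightarrow> complex ^ 'n ^ 'n \<Rightarrow> complex) \<Rightarrow>
   ((complex ^ 'n ^ 'n \<Rightarrow> complex) \<Rightarrow> complex ^ 'n ^ 'n) \<Rightarrow> bool"
  where "root_generators \<h> Hs m \<alpha> e \<longleftrightarrow>
    (\<forall>\<beta>\<in>pos_roots \<h> Hs. e \<beta> \<in> root_space \<h> \<beta> \<and> e \<beta> \<noteq> 0) \<and>
    (\<forall>k\<in>{1..2*m-2}. \<forall>j\<in>{1..2*m-1-k}. \<forall>s\<in>{1..2*m-2}. \<forall>l\<in>{1..2*m-1-s}.
       let \<beta> = root_string \<alpha> j k; \<gamma> = root_string \<alpha> l s in
       {\<beta>, \<gamma>, root_add \<beta> \<gamma>} \<subseteq> pos_roots \<h> Hs \<and> (j < l \<or> j = l \<and> k < s) \<longrightarrow>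
       bracket (e \<beta>) (e \<gamma>) = e (root_add \<beta> \<gamma>))"


section \<open>The subalgebra \<open>\<q>\<close> and the complex structure it defines\<close>

definition H_tilde ::
  "(complex ^ 'n ^ 'n) set \<Rightarrow> nat \<Rightarrow> (nat \<Rightarrow> complex ^ 'n ^ 'n \<Rightarrow> complex) \<Rightarrow> nat \<Rightarrow> complex ^ 'n ^ 'n"
  where "H_tilde \<h> m \<alpha> k =
    (let H = (\<lambda>j. killing_dual \<h> (\<alpha> j)) in
     if k = m - 1 then H (m - 1) + 2 *\<^sub>m H m
     else if k = m - 2 then 2 *\<^sub>m H (m - 2) + H (m - 1)
     else H k - 2 *\<^sub>m H (2 * m - 1 - k))"

definition q_algebra ::
  "(complex ^ 'n ^ 'n) set \<Rightarrow> (complex ^ 'n ^ 'n) list \<Rightarrow> nat \<Rightarrow>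
   (nat \<Rightarrow> complex ^ 'n ^ 'n \<Rightarrow> complex) \<Rightarrow>
   ((complex ^ 'n ^ 'n \<Rightarrow> complex) \<Rightarrow> complex ^ 'n ^ 'n) \<Rightarrow> (complex ^ 'n ^ 'n) set"
  where "q_algebra \<h> Hs m \<alpha> e = msp.span
    (H_tilde \<h> m \<alpha> ` {1..m-1} \<union>
     e ` (pos_roots \<h> Hs - {\<alpha> (m - 1)}) \<union>
     {e (\<alpha> (m - 1)) + conj_mat (e (\<alpha> m))})"

text \<open>\<open>J\<close> is the complex structure on \<open>sl(n,\<real>)\<close> whose \<open>i\<close>-eigenspace in \<open>sl(n,\<complex>)\<close> is \<open>\<q>\<close>
  and whose \<open>-i\<close>-eigenspace is \<open>\<sigma>(\<q>)\<close>. Integrability of \<open>J\<close>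
  amounts to \<open>\<q>\<close> being closed under the bracket and is not required separately.\<close>

definition complex_structure_of ::
  "(complex ^ 'n ^ 'n) set \<Rightarrow> (real ^ 'n ^ 'n \<Rightarrow> real ^ 'n ^ 'n) \<Rightarrow> bool"
  where "complex_structure_of \<q> J \<longleftrightarrow>
    mlinear_on sl J \<and> J ` sl \<subseteq> sl \<and> (\<forall>X\<in>sl. J (J X) = - X) \<and>
    {Z \<in> sl. cext J Z = \<i> *\<^sub>m Z} = \<q> \<and>
    {Z \<in> sl. cext J Z = (- \<i>) *\<^sub>m Z} = conj_mat ` \<q>"


section \<open>Compatible metrics and the pluriclosed condition\<close>

definition compatible_metric ::
  "(real ^ 'n ^ 'n \<Rightarrow> real ^ 'n ^ 'n) \<Rightarrow> (real ^ 'n ^ 'n \<Rightarrow> real ^ 'n ^ 'n \<Rightarrow> real) \<Rightarrow> bool"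
  where "compatible_metric J g \<longleftrightarrow>
    (\<forall>X\<in>sl. mfunctional_on sl (g X)) \<and>
    (\<forall>X\<in>sl. \<forall>Y\<in>sl. g X Y = g Y X) \<and>
    (\<forall>X\<in>sl. X \<noteq> 0 \<longrightarrow> g X X > 0) \<and>
    (\<forall>X\<in>sl. \<forall>Y\<in>sl. g (J X) (J Y) = g X Y)"

text \<open>A complex valued \<open>k\<close>-form on \<open>sl(n,\<real>)\<close> is given by its complex multilinear extension to
  \<open>sl(n,\<complex>)\<close>, as a function on lists of length \<open>k\<close>.\<close>

type_synonym 'n cform = "(complex ^ 'n ^ 'n) list \<Rightarrow> complex"

text \<open>The Chevalley--Eilenberg differential
  \<open>d\<eta>(X\<^sub>0,\<dots>,X\<^sub>k) = \<Sum>i<j. (-1)\<^bsup>i+j\<^esup> \<eta>([X\<^sub>i,X\<^sub>j], X\<^sub>0,\<dots>)\<close>, with \<open>X\<^sub>i\<close> and \<open>X\<^sub>j\<close> omitted from the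
  remaining arguments.\<close>

definition ce_d :: "'n cform \<Rightarrow> 'n::finite cform"
  where "ce_d \<eta> xs =
    (\<Sum>(i, j)\<in>{(i, j). i < j \<and> j < length xs}.
       (-1) ^ (i + j) * \<eta> (bracket (xs ! i) (xs ! j) # nths xs (- {i, j})))"

definition part10 :: "(real ^ 'n ^ 'n \<Rightarrow> real ^ 'n ^ 'n) \<Rightarrow> complex ^ 'n ^ 'n \<Rightarrow> complex ^ 'n ^ 'n"
  where "part10 J Z = (1/2) *\<^sub>m (Z - \<i> *\<^sub>m cext J Z)"

definition part01 :: "(real ^ 'n ^ 'n \<Rightarrow> real ^ 'n ^ 'n) \<Rightarrow> complex ^ 'n ^ 'n \<Rightarrow> complex ^ 'n ^ 'n"
  where "part01 J Z = (1/2) *\<^sub>m (Z + \<i> *\<^sub>m cext J Z)"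

text \<open>The component of bidegree \<open>(p,q)\<close> of a \<open>(p+q)\<close>-form: expand every argument into its
  \<open>(1,0)\<close>- and \<open>(0,1)\<close>-part and keep the terms with exactly \<open>p\<close> arguments of type \<open>(1,0)\<close>.\<close>

definition bidegree_part ::
  "(real ^ 'n ^ 'n \<Rightarrow> real ^ 'n ^ 'n) \<Rightarrow> nat \<Rightarrow> nat \<Rightarrow> 'n cform \<Rightarrow> 'n::finite cform"
  where "bidegree_part J p q \<eta> xs =
    (if length xs = p + q
     then \<Sum>S\<in>{S. S \<subseteq> {..<p + q} \<and> card S = p}.
       \<eta> (map (\<lambda>i. if i \<in> S then part10 J (xs ! i) else part01 J (xs ! i)) [0..<p + q])
     else 0)"

text \<open>\<open>\<partial>\<close> and its conjugate on \<open>k\<close>-forms: on the component of bidegree \<open>(p,k-p)\<close> they are the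
  components of \<open>d\<close> of bidegree \<open>(p+1,k-p)\<close> and \<open>(p,k-p+1)\<close>. The degree is read off the number
  of arguments.\<close>

definition del_op :: "(real ^ 'n ^ 'n \<Rightarrow> real ^ 'n ^ 'n) \<Rightarrow> 'n cform \<Rightarrow> 'n::finite cform"
  where "del_op J \<eta> xs =
    (let k = length xs - 1
     in \<Sum>p\<le>k. bidegree_part J (p + 1) (k - p) (ce_d (bidegree_part J p (k - p) \<eta>)) xs)"

definition delbar_op :: "(real ^ 'n ^ 'n \<Rightarrow> real ^ 'n ^ 'n) \<Rightarrow> 'n cform \<Rightarrow> 'n::finite cform"
  where "delbar_op J \<eta> xs =
    (let k = length xs - 1
     in \<Sum>p\<le>k. bidegree_part J p (k - p + 1) (ce_d (bidegree_part J p (k - p) \<eta>)) xs)"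

definition fundamental_form ::
  "(real ^ 'n ^ 'n \<Rightarrow> real ^ 'n ^ 'n) \<Rightarrow> (real ^ 'n ^ 'n \<Rightarrow> real ^ 'n ^ 'n \<Rightarrow> real) \<Rightarrow> 'n::finite cform"
  where "fundamental_form J g xs = cext2 (\<lambda>X Y. g (J X) Y) (xs ! 0) (xs ! 1)"

definition pluriclosed ::
  "(real ^ 'n ^ 'n \<Rightarrow> real ^ 'n ^ 'n) \<Rightarrow> (real ^ 'n::finite ^ 'n \<Rightarrow> real ^ 'n ^ 'n \<Rightarrow> real) \<Rightarrow> bool"
  where "pluriclosed J g \<longleftrightarrow>
    (\<forall>xs. length xs = 4 \<and> set xs \<subseteq> sl_complex \<longrightarrow>
       del_op J (delbar_op J (fundamental_form J g)) xs = 0)"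

end

theory Submission
  imports Defs "HOL-Computational_Algebra.Fundamental_Theorem_Algebra"
begin

text \<open>The obstruction lives in the copy of \<open>sl(3)\<close> spanned by the two middle simple roots. Let \<open>X\<close> be
  a root vector for \<open>\<alpha>\<^sub>m\<close>, let \<open>Y\<close> be one for \<open>\<alpha>\<^sub>m\<^sub>-\<^sub>1 + \<alpha>\<^sub>m\<close>, and let \<open>H\<close> be the element of \<open>\<q>\<close> of index
  \<open>m - 1\<close> in the torus. All three lie in \<open>\<q>\<close>. As \<open>\<sigma>(\<alpha>\<^sub>m) = - \<alpha>\<^sub>m\<^sub>-\<^sub>1\<close>, the vectors \<open>\<sigma> X\<close> and \<open>\<sigma> Y\<close> are root
  vectors for \<open>- \<alpha>\<^sub>m\<^sub>-\<^sub>1\<close> and \<open>- (\<alpha>\<^sub>m\<^sub>-\<^sub>1 + \<alpha>\<^sub>m)\<close>. Hence \<open>[X, Y] = [X, \<sigma> X] = [X, \<sigma> H] = 0\<close>, the brackets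
  \<open>[X, \<sigma> Y]\<close>, \<open>[Y, \<sigma> X]\<close> and \<open>[H, X]\<close> are multiples of \<open>\<sigma> X\<close>, \<open>X\<close> and \<open>X\<close>, and \<open>[Y, \<sigma> Y]\<close> is a
  nonzero multiple of \<open>H\<^sub>m\<^sub>-\<^sub>1 + H\<^sub>m = (H - \<sigma> H) / 3\<close> (lemma \<open>middle_relations\<close>). For every compatible
  metric, the value of \<open>\<partial>\<close> of \<open>\<partial>\<close>-bar of its fundamental form at \<open>X, Y, \<sigma> X, \<sigma> Y\<close> then reduces to a
  nonzero multiple of the squared length of \<open>X\<close> (lemma \<open>not_pluriclosed\<close>).

  The action of \<open>\<sigma>\<close> on the simple roots is obtained as follows. The Cartan subalgebra is conjugate to
  the diagonal one (\<open>cartan_subalgebra_diagonal\<close>), which makes roots, root vectors and, with the trace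
  formula for the Killing form (\<open>killing_eq\<close>), the elements \<open>H\<^sub>\<phi>\<close> explicit. Since \<open>sl(n,\<complex>)\<close> is the sum of
  \<open>\<q>\<close> and \<open>\<sigma>(\<q>)\<close>, every root is positive or the conjugate of a positive root; counting shows that
  \<open>\<sigma>\<close> exchanges positive and negative roots (\<open>root_signs\<close>). So \<open>- \<sigma>\<close> induces an automorphism of the
  Dynkin diagram, which is a path, and this automorphism is the identity or the flip
  (\<open>path_automorphism\<close>). The identity is impossible as \<open>\<sigma>\<close> would then map \<open>H\<close> to \<open>- H\<close>, an element of
  \<open>\<q> \<inter> \<sigma>(\<q>)\<close> (\<open>twist_middle\<close>).\<close>


section \<open>Matrix algebra over the field of entries\<close>

lemma mscale_nth [simp]: "(c *\<^sub>m A) $ i $ j = c * A $ i $ j"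
  by (simp add: mscale_def)

lemma mscale_mult_left: "(c *\<^sub>m A) ** B = c *\<^sub>m (A ** B)"
  by (simp add: vec_eq_iff matrix_matrix_mult_def sum_distrib_left mult.assoc)

lemma mscale_mult_right: "A ** (c *\<^sub>m B) = c *\<^sub>m (A ** B)"
  by (simp add: vec_eq_iff matrix_matrix_mult_def sum_distrib_left mult.left_commute)

lemma matrix_mult_add_rdistrib: "((A :: 'a::comm_ring_1 ^ 'n ^ 'm) + B) ** C = A ** C + B ** C"
  by (simp add: vec_eq_iff matrix_matrix_mult_def sum.distrib algebra_simps)

lemma matrix_diff_ldistrib: "(A :: 'a::comm_ring_1 ^ 'n ^ 'm) ** (B - C) = A ** B - A ** C"
  by (simp add: vec_eq_iff matrix_matrix_mult_def sum_subtractf algebra_simps)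

lemma matrix_diff_rdistrib: "((A :: 'a::comm_ring_1 ^ 'n ^ 'm) - B) ** C = A ** C - B ** C"
  by (simp add: vec_eq_iff matrix_matrix_mult_def sum_subtractf algebra_simps)

lemmas matrix_distribs = matrix_add_ldistrib matrix_mult_add_rdistrib matrix_diff_ldistrib
  matrix_diff_rdistrib mscale_mult_left mscale_mult_right

lemma matrix_uminus_left: "(- (A :: 'a::field ^ 'n ^ 'm)) ** B = - (A ** B)"
  by (simp add: vec_eq_iff matrix_matrix_mult_def sum_negf)

lemma matrix_uminus_right: "(A :: 'a::field ^ 'n ^ 'm) ** (- B) = - (A ** B)"
  by (simp add: vec_eq_iff matrix_matrix_mult_def sum_negf)

lemma trace_mscale: "trace (c *\<^sub>m A) = c * trace A"
  by (simp add: trace_def sum_distrib_left)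

lemma bracket_add_right: "bracket C (A + B) = bracket C A + bracket C B"
  and bracket_mscale_left: "bracket (c *\<^sub>m A) C = c *\<^sub>m bracket A C"
  and bracket_mscale_right: "bracket C (c *\<^sub>m A) = c *\<^sub>m bracket C A"
  by (simp_all add: bracket_def matrix_distribs msp.scale_right_diff_distrib)

lemma bracket_swap: "bracket A B = - bracket B A"
  by (simp add: bracket_def)

lemma bracket_zero [simp]: "bracket 0 A = 0" "bracket A 0 = 0"
  by (simp_all add: bracket_def)

lemma bracket_self [simp]: "bracket A A = 0"
  by (simp add: bracket_def)

lemma bracket_in_sl: "bracket A B \<in> sl"
  by (simp add: bracket_def sl_def trace_sub trace_mul_sym[of A B])

lemma subspace_sl: "msp.subspace (sl :: ('a::field ^ 'n ^ 'n) set)"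
  by (auto simp: msp.subspace_def sl_def trace_add trace_mscale, simp add: trace_def)

text \<open>The matrix units.\<close>

definition munit :: "'n \<Rightarrow> 'n \<Rightarrow> 'a::field ^ 'n ^ 'n"
  where "munit i j = (\<chi> k l. if k = i \<and> l = j then 1 else 0)"

lemma munit_nth: "munit i j $ k $ l = (if k = i \<and> l = j then 1 else 0)"
  by (simp add: munit_def)

lemma mult_munit_nth: "(A ** munit i j) $ k $ l = (if l = j then A $ k $ i else 0)"
proof -
  have "(A ** munit i j) $ k $ l = (\<Sum>p\<in>UNIV. if p = i then (if l = j then A $ k $ i else 0) else 0)"
    by (simp only: matrix_matrix_mult_def vec_lambda_beta) (rule sum.cong, auto simp: munit_nth)
  then show ?thesis by simp
qed

lemma munit_mult_nth: "(munit i j ** A) $ k $ l = (if k = i then A $ j $ l else 0)"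
proof -
  have "(munit i j ** A) $ k $ l = (\<Sum>p\<in>UNIV. if p = j then (if k = i then A $ j $ l else 0) else 0)"
    by (simp only: matrix_matrix_mult_def vec_lambda_beta) (rule sum.cong, auto simp: munit_nth)
  then show ?thesis by simp
qed

lemma munit_mult_munit: "munit i j ** munit k l = (if j = k then munit i l else 0)"
  by (simp add: vec_eq_iff munit_mult_nth munit_nth)

lemma matrix_eq_sum_munit: "A = (\<Sum>i\<in>UNIV. \<Sum>j\<in>UNIV. A $ i $ j *\<^sub>m munit i j)"
proof -
  have "(\<Sum>i\<in>UNIV. \<Sum>j\<in>UNIV. A $ i $ j *\<^sub>m munit i j) $ k $ l =
      (\<Sum>i\<in>UNIV. if i = k then A $ k $ l else 0)" for k l
  proof (simp only: sum_component, rule sum.cong[OF refl])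
    fix i
    have "(\<Sum>j\<in>UNIV. (A $ i $ j *\<^sub>m munit i j) $ k $ l) =
        (\<Sum>j\<in>UNIV. if j = l then (if i = k then A $ k $ l else 0) else 0)"
      by (rule sum.cong) (auto simp: munit_nth)
    then show "(\<Sum>j\<in>UNIV. (A $ i $ j *\<^sub>m munit i j) $ k $ l) = (if i = k then A $ k $ l else 0)"
      by simp
  qed
  then show ?thesis by (simp add: vec_eq_iff)
qed

lemma span_munits: "msp.span ((\<lambda>(i, j). munit i j) ` UNIV) = (UNIV :: ('a::field ^ 'n ^ 'n) set)"
proof -
  have "A \<in> msp.span ((\<lambda>(i, j). munit i j) ` UNIV)" for A :: "'a ^ 'n ^ 'n"
    by (subst matrix_eq_sum_munit[of A])
      (intro msp.span_sum msp.span_scale msp.span_base, auto intro: image_eqI[where x = "(_, _)"])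
  then show ?thesis by blast
qed

lemma independent_finite: "msp.independent B \<Longrightarrow> finite (B :: ('a::field ^ 'n ^ 'n) set)"
  using msp.independent_span_bound[of "(\<lambda>(i, j). munit i j) ` UNIV" B] by (simp add: span_munits)


section \<open>The Killing form as a trace form\<close>

text \<open>The projection of all matrices onto the trace-free ones along the scalar matrices.\<close>

definition traceless :: "'a::field ^ 'n ^ 'n \<Rightarrow> 'a ^ 'n ^ 'n"
  where "traceless A = A - (trace A / of_nat CARD('n)) *\<^sub>m mat 1"

text \<open>An endomorphism of all matrices that kills the identity and has values in \<open>sl\<close> has the same
  trace on \<open>sl\<close> as on all matrices, where the trace can be read off from the matrix units. The proof
  expands the projected matrix units in the basis of \<open>sl\<close> chosen by \<^const>\<open>trace_on\<close>, and the
  images of the basis vectors in the matrix units.\<close>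

lemma trace_on_sl:
  fixes f :: "'a::{field_char_0} ^ 'n ^ 'n \<Rightarrow> 'a ^ 'n ^ 'n"
  assumes add: "\<And>A B. f (A + B) = f A + f B"
    and scale: "\<And>c A. f (c *\<^sub>m A) = c *\<^sub>m f A"
    and one: "f (mat 1) = 0" and into: "\<And>A. f A \<in> sl"
  shows "trace_on sl f = (\<Sum>i\<in>UNIV. \<Sum>j\<in>UNIV. f (munit i j) $ i $ j)"
proof -
  have tl_add: "traceless (A + B) = traceless A + traceless B"
    and tl_scale: "traceless (c *\<^sub>m A) = c *\<^sub>m traceless A" for c and A B :: "'a ^ 'n ^ 'n"
    by (simp_all add: traceless_def trace_add trace_mscale vec_eq_iff add_divide_distrib algebra_simps)
  have tl_sl: "traceless A \<in> sl" for A :: "'a ^ 'n ^ 'n"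
    by (simp add: traceless_def sl_def trace_sub trace_mscale trace_I)
  have tl_id: "traceless A = A" if "A \<in> sl" for A :: "'a ^ 'n ^ 'n"
    using that by (simp add: traceless_def sl_def)
  have f_diff: "f (A - B) = f A - f B" for A B
    using add[of "A - B" B] by (simp add: algebra_simps)
  have f_tl: "f (traceless A) = f A" for A
    by (simp add: traceless_def f_diff scale one)
  have f_zero: "f 0 = 0" using add[of 0 0] by simp
  have f_sum: "f (\<Sum>x\<in>S. h x) = (\<Sum>x\<in>S. f (h x))" for h :: "'a ^ 'n ^ 'n \<Rightarrow> 'a ^ 'n ^ 'n" and S
    by (induction S rule: infinite_finite_induct) (simp_all add: f_zero add)
  have tl_sum: "traceless (\<Sum>x\<in>S. h x) = (\<Sum>x\<in>S. traceless (h x))" for h :: "'n \<Rightarrow> 'a ^ 'n ^ 'n" and S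
    by (induction S rule: infinite_finite_induct) (simp_all add: tl_add, simp_all add: traceless_def trace_def)
  define b where "b = (SOME b. msp.independent b \<and> msp.span b = (sl :: ('a ^ 'n ^ 'n) set))"
  have "\<exists>b. msp.independent b \<and> msp.span b = (sl :: ('a ^ 'n ^ 'n) set)"
    by (metis msp.basis_exists msp.span_subspace subspace_sl)
  then have b: "msp.independent b" "msp.span b = (sl :: ('a ^ 'n ^ 'n) set)"
    unfolding b_def by (metis (mono_tags, lifting) someI_ex)+
  then have fin: "finite b" by (simp add: independent_finite)
  have rep: "(\<Sum>v\<in>b. msp.representation b A v *\<^sub>m v) = A" if "A \<in> sl" for A
    using msp.sum_representation_eq[OF b(1) _ fin subset_refl, of A] that b(2) by simp
  have entry: "f (munit i j) $ i $ j =
      (\<Sum>v\<in>b. msp.representation b (traceless (munit i j)) v * f v $ i $ j)" for i j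
  proof -
    have "f (munit i j) = f (\<Sum>v\<in>b. msp.representation b (traceless (munit i j)) v *\<^sub>m v)"
      by (simp add: rep tl_sl f_tl)
    also have "\<dots> = (\<Sum>v\<in>b. msp.representation b (traceless (munit i j)) v *\<^sub>m f v)"
      by (simp add: f_sum scale)
    finally show ?thesis by simp
  qed
  have rep_sum: "msp.representation b (\<Sum>x\<in>S. h x) v = (\<Sum>x\<in>S. msp.representation b (h x) v)"
    if "\<And>x. h x \<in> sl" for h :: "'n \<Rightarrow> 'a ^ 'n ^ 'n" and S v
    by (subst msp.representation_sum[OF b(1)]) (simp_all add: b(2) that)
  have sum_sl: "(\<Sum>x\<in>S. h x) \<in> sl" if "\<And>x. h x \<in> sl" for h :: "'n \<Rightarrow> 'a ^ 'n ^ 'n" and S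
    by (rule msp.subspace_sum[OF subspace_sl]) (rule that)
  have scale_sl: "c *\<^sub>m A \<in> sl" if "A \<in> sl" for c and A :: "'a ^ 'n ^ 'n"
    by (rule msp.subspace_scale[OF subspace_sl that])
  have coeff: "msp.representation b (f v) v =
      (\<Sum>i\<in>UNIV. \<Sum>j\<in>UNIV. f v $ i $ j * msp.representation b (traceless (munit i j)) v)" for v
  proof -
    have "f v = traceless (\<Sum>i\<in>UNIV. \<Sum>j\<in>UNIV. f v $ i $ j *\<^sub>m munit i j)"
      by (simp add: matrix_eq_sum_munit[of "f v", symmetric] tl_id into)
    also have "\<dots> = (\<Sum>i\<in>UNIV. \<Sum>j\<in>UNIV. f v $ i $ j *\<^sub>m traceless (munit i j))"
      by (simp add: tl_sum tl_scale)
    finally have "msp.representation b (f v) v =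
        msp.representation b (\<Sum>i\<in>UNIV. \<Sum>j\<in>UNIV. f v $ i $ j *\<^sub>m traceless (munit i j)) v" by simp
    also have "\<dots> = (\<Sum>i\<in>UNIV. \<Sum>j\<in>UNIV. f v $ i $ j * msp.representation b (traceless (munit i j)) v)"
      by (simp add: rep_sum sum_sl scale_sl tl_sl msp.representation_scale[OF b(1)] b(2))
    finally show ?thesis .
  qed
  have "trace_on sl f = (\<Sum>v\<in>b. msp.representation b (f v) v)"
    by (simp add: trace_on_def b_def[symmetric] Let_def)
  also have "\<dots> = (\<Sum>v\<in>b. \<Sum>i\<in>UNIV. \<Sum>j\<in>UNIV.
      f v $ i $ j * msp.representation b (traceless (munit i j)) v)"
    by (simp add: coeff)
  also have "\<dots> = (\<Sum>i\<in>UNIV. \<Sum>j\<in>UNIV. \<Sum>v\<in>b.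
      f v $ i $ j * msp.representation b (traceless (munit i j)) v)"
    by (subst sum.swap, rule sum.cong[OF refl], rule sum.swap)
  finally show ?thesis by (simp add: entry mult.commute)
qed

lemma killing_eq:
  fixes X Y :: "'a::{field_char_0} ^ 'n ^ 'n"
  assumes "X \<in> sl" "Y \<in> sl"
  shows "killing X Y = 2 * of_nat CARD('n) * trace (X ** Y)"
proof -
  have tr: "trace X = 0" "trace Y = 0" using assms by (simp_all add: sl_def)
  have "killing X Y = (\<Sum>i\<in>UNIV. \<Sum>j\<in>UNIV. bracket X (bracket Y (munit i j)) $ i $ j)"
    unfolding killing_def
    by (rule trace_on_sl)
      (simp_all add: bracket_add_right bracket_mscale_right bracket_in_sl, simp add: bracket_def)
  also have "\<dots> = (\<Sum>i\<in>UNIV. \<Sum>j\<in>UNIV.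
      ((X ** Y) $ i $ i + (Y ** X) $ j $ j) - (X $ i $ i * Y $ j $ j + Y $ i $ i * X $ j $ j))"
  proof (intro sum.cong refl)
    fix i j :: 'n
    have "bracket X (bracket Y (munit i j)) = X ** Y ** munit i j + munit i j ** (Y ** X)
        - (X ** munit i j ** Y + Y ** munit i j ** X)"
      by (simp add: bracket_def matrix_distribs matrix_mul_assoc)
    moreover have "(A ** munit i j ** B) $ i $ j = A $ i $ i * B $ j $ j" for A B :: "'a ^ 'n ^ 'n"
    proof -
      have "(A ** munit i j ** B) $ i $ j = (\<Sum>k\<in>UNIV. (A ** munit i j) $ i $ k * B $ k $ j)"
        by (simp add: matrix_matrix_mult_def)
      also have "\<dots> = (\<Sum>k\<in>UNIV. if k = j then A $ i $ i * B $ j $ j else 0)"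
        by (rule sum.cong) (simp_all add: mult_munit_nth)
      finally show ?thesis by simp
    qed
    ultimately show "bracket X (bracket Y (munit i j)) $ i $ j =
      ((X ** Y) $ i $ i + (Y ** X) $ j $ j) - (X $ i $ i * Y $ j $ j + Y $ i $ i * X $ j $ j)"
      by (simp add: mult_munit_nth munit_mult_nth)
  qed
  also have "\<dots> = of_nat CARD('n) * trace (X ** Y) + of_nat CARD('n) * trace (Y ** X)
      - (trace X * trace Y + trace Y * trace X)"
    by (simp add: sum_subtractf sum.distrib sum_distrib_left[symmetric] sum_distrib_right[symmetric] trace_def)
  finally show ?thesis by (simp add: tr trace_mul_sym[of Y X])
qed

section \<open>Conjugation\<close>

lemma conj_mat_nth [simp]: "conj_mat Z $ i $ j = cnj (Z $ i $ j)"
  by (simp add: conj_mat_def)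

lemma conj_mat_conj_mat [simp]: "conj_mat (conj_mat Z) = Z"
  by (simp add: vec_eq_iff)

lemma conj_mat_mult: "conj_mat (A ** B) = conj_mat A ** conj_mat B"
  by (simp add: vec_eq_iff matrix_matrix_mult_def)

lemma conj_mat_add: "conj_mat (A + B) = conj_mat A + conj_mat B"
  and conj_mat_diff: "conj_mat (A - B) = conj_mat A - conj_mat B"
  and conj_mat_mscale: "conj_mat (c *\<^sub>m A) = cnj c *\<^sub>m conj_mat A"
  and conj_mat_zero [simp]: "conj_mat 0 = 0"
  by (simp_all add: vec_eq_iff)

lemma conj_mat_bracket: "conj_mat (bracket A B) = bracket (conj_mat A) (conj_mat B)"
  by (simp add: bracket_def conj_mat_diff conj_mat_mult)

lemma trace_conj_mat: "trace (conj_mat A) = cnj (trace A)"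
  by (simp add: trace_def)

lemma conj_mat_sl [simp]: "conj_mat A \<in> sl \<longleftrightarrow> A \<in> sl"
  by (simp add: sl_def trace_conj_mat)

lemma killing_conj_mat:
  assumes "X \<in> sl" "Y \<in> sl"
  shows "killing (conj_mat X) (conj_mat Y) = cnj (killing X Y)"
  using assms by (simp add: killing_eq flip: conj_mat_mult) (simp add: trace_conj_mat)

lemma conj_mat_complexify:
  assumes "msp.subspace V" "Z \<in> complexify V"
  shows "conj_mat Z \<in> complexify V"
proof -
  obtain X Y where XY: "X \<in> V" "Y \<in> V" "Z = of_real_mat X + \<i> *\<^sub>m of_real_mat Y"
    using assms(2) by (auto simp: complexify_def)
  have "conj_mat Z = of_real_mat X + \<i> *\<^sub>m of_real_mat (- Y)"
    by (simp add: XY(3) vec_eq_iff of_real_mat_def)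
  then show ?thesis using XY msp.subspace_neg[OF assms(1)] by (auto simp: complexify_def)
qed


section \<open>Cartan subalgebras are conjugate to the diagonal one\<close>

text \<open>The value \<open>p(A) v\<close> of a polynomial \<open>p\<close> at a matrix \<open>A\<close>, applied to a vector \<open>v\<close>.\<close>

definition poly_act :: "'a::field ^ 'n ^ 'n \<Rightarrow> 'a ^ 'n \<Rightarrow> 'a poly \<Rightarrow> 'a ^ 'n"
  where "poly_act A v p = (\<Sum>i\<le>degree p. coeff p i *s ((\<lambda>w. A *v w) ^^ i) v)"

lemma poly_act_bound:
  assumes "degree p \<le> N"
  shows "poly_act A v p = (\<Sum>i\<le>N. coeff p i *s ((\<lambda>w. A *v w) ^^ i) v)"
  unfolding poly_act_def
  by (rule sum.mono_neutral_left) (use assms in \<open>auto simp: coeff_eq_0\<close>)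

lemma matrix_vector_sum: "A *v (\<Sum>x\<in>S. f x) = (\<Sum>x\<in>S. A *v f x)" for A :: "'a::field ^ 'n ^ 'm"
  by (induction S rule: infinite_finite_induct) (simp_all add: matrix_vector_right_distrib)

lemma matrix_vector_smult: "A *v (c *s x) = c *s (A *v x)" for A :: "'a::field ^ 'n ^ 'm"
  by (simp add: vec_eq_iff matrix_vector_mult_def sum_distrib_left algebra_simps)

lemma poly_act_linear_factor:
  "poly_act A v ([:-z, 1:] * q) = A *v poly_act A v q - z *s poly_act A v q"
proof -
  let ?w = "\<lambda>i. ((\<lambda>w. A *v w) ^^ i) v"
  have "degree ([:-z, 1:] * q) \<le> Suc (degree q)"
    using degree_mult_le[of "[:-z, 1:]" q] by simp
  then have "poly_act A v ([:-z, 1:] * q) =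
      (\<Sum>i\<le>Suc (degree q). coeff ([:-z, 1:] * q) i *s ?w i)"
    by (rule poly_act_bound)
  also have "\<dots> = (\<Sum>i\<le>Suc (degree q). coeff (pCons 0 q) i *s ?w i)
      - (\<Sum>i\<le>Suc (degree q). (z * coeff q i) *s ?w i)"
    by (simp add: vector_sub_rdistrib sum_subtractf[symmetric])
  also have "(\<Sum>i\<le>Suc (degree q). coeff (pCons 0 q) i *s ?w i) = (\<Sum>i\<le>degree q. coeff q i *s (A *v ?w i))"
    by (subst sum.atMost_Suc_shift) simp
  also have "\<dots> = A *v poly_act A v q"
    by (simp add: poly_act_def matrix_vector_sum matrix_vector_smult)
  also have "(\<Sum>i\<le>Suc (degree q). (z * coeff q i) *s ?w i) = z *s poly_act A v q"
    by (simp add: poly_act_bound[of q "Suc (degree q)"] vec.scale_sum_right coeff_eq_0)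
  finally show ?thesis .
qed

lemma linear_relation:
  fixes f :: "nat \<Rightarrow> 'a::field ^ 'n"
  shows "\<exists>c. (\<exists>i\<le>CARD('n). c i \<noteq> 0) \<and> (\<Sum>i\<le>CARD('n). c i *s f i) = 0"
proof (cases "inj_on f {..CARD('n)}")
  case False
  then obtain i j where ij: "i \<le> CARD('n)" "j \<le> CARD('n)" "i \<noteq> j" "f i = f j"
    by (auto simp: inj_on_def)
  define c where "c = (\<lambda>k. if k = i then 1 else if k = j then - 1 else (0::'a))"
  have "(\<Sum>k\<le>CARD('n). c k *s f k) = (\<Sum>k\<in>{i, j}. c k *s f k)"
    by (rule sum.mono_neutral_right) (use ij in \<open>auto simp: c_def\<close>)
  also have "\<dots> = 0" using ij by (simp add: c_def)
  finally show ?thesis using ij(1) by (intro exI[of _ c]) (auto simp: c_def intro!: exI[of _ i])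
next
  case True
  have "\<not> vec.independent (f ` {..CARD('n)})"
  proof
    assume "vec.independent (f ` {..CARD('n)})"
    then have "card (f ` {..CARD('n)}) \<le> card (cart_basis :: ('a ^ 'n) set)"
      using vec.independent_span_bound[OF finite_cart_basis] by (metis span_cart_basis subset_UNIV)
    then show False by (simp add: card_image True card_cart_basis)
  qed
  then obtain u v where u: "v \<in> f ` {..CARD('n)}" "u v \<noteq> 0" "(\<Sum>v\<in>f ` {..CARD('n)}. u v *s v) = 0"
    by (auto simp: vec.dependent_finite)
  then show ?thesis
    by (intro exI[of _ "u \<circ> f"]) (auto simp: sum.reindex[OF True])
qed

text \<open>A vector is annihilated by some nonzero polynomial in the matrix; peeling off linear factors
  produces an eigenvector.\<close>

lemma eigenvector_exists:
  fixes A :: "complex ^ 'n ^ 'n"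
  shows "\<exists>v c. v \<noteq> 0 \<and> A *v v = c *s v"
proof -
  define v :: "complex ^ 'n" where "v = 1"
  have v: "v \<noteq> 0" by (simp add: v_def vec_eq_iff)
  obtain c i where c: "i \<le> CARD('n)" "c i \<noteq> 0" "(\<Sum>i\<le>CARD('n). c i *s ((\<lambda>w. A *v w) ^^ i) v) = 0"
    using linear_relation[of "\<lambda>i. ((\<lambda>w. A *v w) ^^ i) v"] by blast
  define p where "p = (\<Sum>i\<le>CARD('n). monom (c i) i)"
  have coeff_p: "coeff p j = (if j \<le> CARD('n) then c j else 0)" for j
    by (simp add: p_def coeff_sum)
  have "degree p \<le> CARD('n)" by (rule degree_le) (simp add: coeff_p)
  then have "poly_act A v p = 0" using c(3) by (simp add: poly_act_bound coeff_p)
  moreover have "p \<noteq> 0" using c(1,2) coeff_p[of i] by auto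
  ultimately show ?thesis
  proof (induction "degree p" arbitrary: p rule: less_induct)
    case less
    have "degree p \<noteq> 0"
    proof
      assume "degree p = 0"
      then obtain a where "p = [:a:]" by (rule degree_eq_zeroE)
      with less.prems v show False by (simp add: poly_act_def)
    qed
    then obtain z where "poly p z = 0"
      by (metis constant_degree fundamental_theorem_of_algebra)
    then obtain q where q: "p = [:-z, 1:] * q" by (auto simp: poly_eq_0_iff_dvd)
    then have "q \<noteq> 0" using less.prems by auto
    then have "degree q < degree p" unfolding q by (subst degree_mult_eq) auto
    show ?case
    proof (cases "poly_act A v q = 0")
      case True
      then show ?thesis using less.hyps \<open>degree q < degree p\<close> \<open>q \<noteq> 0\<close> by blast
    next
      case False
      moreover have "A *v poly_act A v q = z *s poly_act A v q"
        using less.prems(1) unfolding q poly_act_linear_factor by simp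
      ultimately show ?thesis by blast
    qed
  qed
qed

text \<open>If \<open>v\<close> is an eigenvector of \<open>H\<close> and \<open>X\<close> one of \<open>ad H\<close>, then \<open>X v\<close> is zero or an eigenvector
  of \<open>H\<close>; as all vectors are of the form \<open>X v\<close>, ad-semisimple matrices are diagonalisable.\<close>

lemma ad_semisimple_eigenvectors_span:
  fixes H :: "complex ^ 'n ^ 'n"
  assumes "ad_semisimple H"
  shows "vec.span {v. \<exists>c. H *v v = c *s v} = UNIV"
proof -
  let ?E = "{v. \<exists>c. H *v v = c *s v}"
  obtain v c where v: "v \<noteq> 0" "H *v v = c *s v" using eigenvector_exists by blast
  let ?S = "{X. X *v v \<in> vec.span ?E}"
  have smult: "(d *\<^sub>m X) *v v = d *s (X *v v)" for d X
    by (simp add: vec_eq_iff matrix_vector_mult_def sum_distrib_left mult.assoc)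
  have sub: "msp.subspace ?S"
    by (auto simp: msp.subspace_def matrix_vector_mult_add_rdistrib smult
        intro: vec.span_add vec.span_scale vec.span_zero)
  have "{X \<in> sl. \<exists>c. bracket H X = c *\<^sub>m X} \<subseteq> ?S"
  proof safe
    fix X d assume X: "bracket H X = d *\<^sub>m X"
    have "H *v (X *v v) = (X ** H + d *\<^sub>m X) *v v"
      by (simp add: X[symmetric] bracket_def matrix_vector_mul_assoc)
    also have "\<dots> = (c + d) *s (X *v v)"
      by (simp add: matrix_vector_mult_add_rdistrib smult v matrix_vector_mul_assoc[symmetric]
          matrix_vector_smult vector_sadd_rdistrib)
    finally show "X *v v \<in> vec.span ?E" by (intro vec.span_base CollectI exI)
  qed
  then have "sl \<subseteq> ?S" using msp.span_minimal[OF _ sub, of "{X \<in> sl. \<exists>c. bracket H X = c *\<^sub>m X}"] assms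
    by (simp only: ad_semisimple_def)
  have "w \<in> vec.span ?E" for w
  proof -
    \<comment> \<open>A matrix \<open>M\<close> with \<open>M v = w\<close>; its trace-free part lies in the span of the eigenvectors of \<open>ad H\<close>.\<close>
    obtain k where k: "v $ k \<noteq> 0" using v(1) by (auto simp: vec_eq_iff)
    define M :: "complex ^ 'n ^ 'n" where "M = (\<chi> i j. if j = k then w $ i / v $ k else 0)"
    have "M *v v = w"
    proof -
      have "(\<Sum>j\<in>UNIV. (if j = k then w $ i / v $ k else 0) * v $ j) =
          (\<Sum>j\<in>UNIV. if j = k then w $ i else 0)" for i
        by (rule sum.cong) (use k in auto)
      then show ?thesis by (simp add: M_def vec_eq_iff matrix_vector_mult_def)
    qed
    define t where "t = trace M / of_nat CARD('n)"
    have "M - t *\<^sub>m mat 1 \<in> sl"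
      by (simp add: sl_def trace_sub trace_mscale trace_I t_def)
    then have "(M - t *\<^sub>m mat 1) *v v \<in> vec.span ?E" using \<open>sl \<subseteq> ?S\<close> by blast
    then have "w - t *s v \<in> vec.span ?E"
      by (simp add: matrix_vector_mult_diff_rdistrib smult \<open>M *v v = w\<close>)
    moreover have "t *s v \<in> vec.span ?E" using v by (auto intro: vec.span_scale vec.span_base)
    ultimately show ?thesis using vec.span_add by fastforce
  qed
  then show ?thesis by blast
qed

lemma eigenvectors_sum_zero:
  fixes A :: "'a::field ^ 'n ^ 'n"
  assumes "finite C" "\<And>c. c \<in> C \<Longrightarrow> A *v u c = c *s u c" "(\<Sum>c\<in>C. u c) = 0" "c \<in> C"
  shows "u c = 0"
  using assms
proof (induction C arbitrary: u c rule: finite_induct)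
  case (insert c0 C)
  have "(\<Sum>c\<in>C. (c - c0) *s u c) = (\<Sum>c\<in>insert c0 C. (c - c0) *s u c)"
    using insert.hyps by simp
  also have "\<dots> = (\<Sum>c\<in>insert c0 C. A *v u c - c0 *s u c)"
    by (rule sum.cong) (auto simp: insert.prems(1) vector_sub_rdistrib)
  also have "\<dots> = A *v (\<Sum>c\<in>insert c0 C. u c) - c0 *s (\<Sum>c\<in>insert c0 C. u c)"
    by (simp add: sum_subtractf matrix_vector_sum vec.scale_sum_right
        del: sum.insert)
  finally have sum0: "(\<Sum>c\<in>C. (c - c0) *s u c) = 0" by (simp add: insert.prems(2))
  have "(d - c0) *s u d = 0" if "d \<in> C" for d
  proof (rule insert.IH[where u = "\<lambda>d. (d - c0) *s u d", OF _ sum0 that])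
    show "A *v ((e - c0) *s u e) = e *s ((e - c0) *s u e)" if "e \<in> C" for e
      by (simp only: matrix_vector_smult insert.prems(1)[OF insertI2[OF that]] vec.scale_left_commute)
  qed
  then have *: "u d = 0" if "d \<in> C" for d using that insert.hyps(2) by fastforce
  then have "u c0 = 0" using insert.prems(2) insert.hyps by simp
  with * insert.prems(3) show ?case by blast
qed simp

lemma eigenvector_decomposition:
  fixes A :: "'a::field ^ 'n ^ 'n"
  assumes "v \<in> vec.span {v. \<exists>c. A *v v = c *s v}"
  shows "\<exists>C w. finite C \<and> (\<forall>c. A *v w c = c *s w c) \<and> (\<forall>c. c \<notin> C \<longrightarrow> w c = 0) \<and> v = (\<Sum>c\<in>C. w c)"
  using assms
proof (induction rule: vec.span_induct_alt)
  case base
  show ?case by (rule exI[of _ "{}"], rule exI[of _ "\<lambda>_. 0"]) simp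
next
  case (step a x y)
  obtain C w where w: "finite C" "\<forall>c. A *v w c = c *s w c" "\<forall>c. c \<notin> C \<longrightarrow> w c = 0" "y = (\<Sum>c\<in>C. w c)"
    using step.IH by blast
  obtain d where d: "A *v x = d *s x" using step.hyps by blast
  define w' where "w' = (\<lambda>c. if c = d then w d + a *s x else w c)"
  have "(\<Sum>c\<in>insert d C. w' c) = (\<Sum>c\<in>insert d C. w c + (if c = d then a *s x else 0))"
    by (rule sum.cong) (auto simp: w'_def)
  also have "\<dots> = (\<Sum>c\<in>insert d C. w c) + a *s x"
    using w(1) by (simp only: sum.distrib) simp
  also have "(\<Sum>c\<in>insert d C. w c) = y"
    unfolding w(4) by (rule sum.mono_neutral_right) (use w in auto)
  finally have "a *s x + y = (\<Sum>c\<in>insert d C. w' c)" by simp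
  moreover have "A *v w' c = c *s w' c" for c
    using w(2) d by (simp add: w'_def matrix_vector_right_distrib matrix_vector_smult
        vector_add_ldistrib vec.scale_left_commute)
  moreover have "c \<notin> insert d C \<longrightarrow> w' c = 0" for c using w(3) by (simp add: w'_def)
  ultimately show ?case using w(1) by (intro exI[of _ "insert d C"] exI[of _ w']) blast
qed

text \<open>Commuting diagonalisable matrices are simultaneously diagonalisable: the components of a joint
  eigenvector of \<open>B\<close> with respect to the eigenspaces of a further matrix \<open>A\<close> are again eigenvectors
  of the elements of \<open>B\<close>.\<close>

lemma joint_eigenvectors_span:
  fixes B :: "('a::field ^ 'n ^ 'n) set"
  assumes "finite B" "\<And>A A'. A \<in> B \<Longrightarrow> A' \<in> B \<Longrightarrow> A ** A' = A' ** A"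
    and "\<And>A. A \<in> B \<Longrightarrow> vec.span {v. \<exists>c. A *v v = c *s v} = UNIV"
  shows "vec.span {v. \<forall>A\<in>B. \<exists>c. A *v v = c *s v} = UNIV"
  using assms
proof (induction B rule: finite_induct)
  case empty
  show ?case by simp
next
  case (insert A B)
  let ?V = "\<lambda>B. {v. \<forall>A\<in>B. \<exists>c. A *v v = c *s v}"
  have IH: "vec.span (?V B) = UNIV" by (rule insert.IH) (simp_all add: insert.prems)
  have "v \<in> vec.span (?V (insert A B))" if v: "v \<in> ?V B" for v
  proof -
    have "v \<in> vec.span {v. \<exists>c. A *v v = c *s v}" using insert.prems(2) by simp
    then obtain C w where w: "finite C" "\<And>c. A *v w c = c *s w c" "v = (\<Sum>c\<in>C. w c)"
      using eigenvector_decomposition[of v A] by blast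
    have "w c \<in> ?V (insert A B)" if c: "c \<in> C" for c
    proof -
      have "\<exists>l. H *v w c = l *s w c" if H: "H \<in> B" for H
      proof -
        obtain l where l: "H *v v = l *s v" using v H by blast
        have comm: "A *v (H *v x) = H *v (A *v x)" for x
          using insert.prems(1)[of A H] H by (simp add: matrix_vector_mul_assoc)
        have "H *v w c - l *s w c = 0"
        proof (rule eigenvectors_sum_zero[OF w(1), of A "\<lambda>c. H *v w c - l *s w c"])
          show "A *v (H *v w d - l *s w d) = d *s (H *v w d - l *s w d)" for d
            by (simp add: matrix_vector_mult_diff_distrib comm w(2) matrix_vector_smult
                vec.scale_right_diff_distrib vec.scale_left_commute)
          show "(\<Sum>c\<in>C. H *v w c - l *s w c) = 0"
            using l by (simp add: sum_subtractf matrix_vector_sum vec.scale_sum_right w(3))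
        qed (rule c)
        then show ?thesis by auto
      qed
      then show ?thesis using w(2) by blast
    qed
    then show ?thesis unfolding w(3) by (intro vec.span_sum vec.span_base)
  qed
  then have "?V B \<subseteq> vec.span (?V (insert A B))" by blast
  then show ?case using IH vec.span_minimal[OF _ vec.subspace_span] by blast
qed

text \<open>The columns of \<open>P\<close> form a basis of joint eigenvectors. The trace-free matrices that are diagonal
  in this basis form an abelian subalgebra containing \<open>\<h>\<close>, hence equal to \<open>\<h>\<close> by maximality.\<close>

theorem cartan_subalgebra_diagonal:
  fixes \<h> :: "(complex ^ 'n ^ 'n) set"
  assumes "cartan_subalgebra \<h>"
  obtains P Q :: "complex ^ 'n ^ 'n" where "P ** Q = mat 1" "Q ** P = mat 1"
    "\<h> = {Z \<in> sl. \<forall>i j. i \<noteq> j \<longrightarrow> (Q ** Z ** P) $ i $ j = 0}"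
proof -
  have abel: "msp.subspace \<h>" "\<h> \<subseteq> sl" "\<And>X Y. X \<in> \<h> \<Longrightarrow> Y \<in> \<h> \<Longrightarrow> bracket X Y = 0"
    and maxi: "\<And>\<b>. abelian_subalgebra \<b> \<Longrightarrow> \<h> \<subseteq> \<b> \<Longrightarrow> \<b> = \<h>"
    and ss: "\<And>H. H \<in> \<h> \<Longrightarrow> ad_semisimple H"
    using assms by (auto simp: cartan_subalgebra_def abelian_subalgebra_def)
  obtain B where B: "B \<subseteq> \<h>" "msp.independent B" "\<h> \<subseteq> msp.span B"
    by (rule msp.basis_exists[of \<h>])
  let ?V = "{v. \<forall>A\<in>B. \<exists>c. A *v v = c *s v}"
  have "vec.span ?V = UNIV"
  proof (rule joint_eigenvectors_span)
    show "finite B" by (rule independent_finite[OF B(2)])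
    show "A ** A' = A' ** A" if "A \<in> B" "A' \<in> B" for A A'
      using abel(3)[of A A'] that B(1) by (auto simp: bracket_def)
    show "vec.span {v. \<exists>c. A *v v = c *s v} = UNIV" if "A \<in> B" for A
      using ad_semisimple_eigenvectors_span ss that B(1) by blast
  qed
  have joint: "\<exists>c. H *v v = c *s v" if "v \<in> ?V" "H \<in> \<h>" for v H
  proof -
    have smult: "(d *\<^sub>m X) *v v = d *s (X *v v)" for d and X :: "complex ^ 'n ^ 'n"
      by (simp add: vec_eq_iff matrix_vector_mult_def sum_distrib_left mult.assoc)
    have "msp.subspace {H. \<exists>c. H *v v = c *s v}"
      unfolding msp.subspace_def
    proof (intro conjI ballI allI)
      show "0 \<in> {H. \<exists>c. H *v v = c *s v}" by (auto intro: exI[of _ 0])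
      show "X + Y \<in> {H. \<exists>c. H *v v = c *s v}"
        if "X \<in> {H. \<exists>c. H *v v = c *s v}" "Y \<in> {H. \<exists>c. H *v v = c *s v}" for X Y
        using that by (auto simp: matrix_vector_mult_add_rdistrib) (metis vector_sadd_rdistrib)
      show "d *\<^sub>m X \<in> {H. \<exists>c. H *v v = c *s v}" if "X \<in> {H. \<exists>c. H *v v = c *s v}" for d X
        using that by (auto simp: smult vector_smult_assoc)
    qed
    then have "msp.span B \<subseteq> {H. \<exists>c. H *v v = c *s v}"
      by (rule msp.span_minimal[rotated]) (use that(1) in blast)
    then show ?thesis using B(3) that(2) by blast
  qed
  obtain E where E: "E \<subseteq> ?V" "vec.independent E" "?V \<subseteq> vec.span E"
    by (rule vec.basis_exists[of ?V])
  have "vec.span E = UNIV"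
    using vec.span_minimal[OF E(3) vec.subspace_span] \<open>vec.span ?V = UNIV\<close> by blast
  then have "card E = CARD('n)"
    using vec.basis_card_eq_dim[of E UNIV] E(2) by (simp add: vec.dim_UNIV card_cart_basis)
  then obtain v :: "'n \<Rightarrow> complex ^ 'n" where v: "bij_betw v UNIV E"
    using finite_same_card_bij[of "UNIV :: 'n set" E] by (metis card_gt_0_iff finite zero_less_card_finite)
  define P :: "complex ^ 'n ^ 'n" where "P = (\<chi> i j. v j $ i)"
  have col: "column j P = v j" for j by (simp add: P_def column_def vec_eq_iff)
  have "columns P = E"
    using v unfolding columns_def col by (auto simp: bij_betw_def)
  then obtain Q where PQ: "P ** Q = mat 1"
    using matrix_right_invertible_span_columns[of P] \<open>vec.span E = UNIV\<close> by auto
  then have QP: "Q ** P = mat 1" by (simp add: matrix_left_right_inverse)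
  let ?T = "{Z \<in> sl. \<forall>i j. i \<noteq> j \<longrightarrow> (Q ** Z ** P) $ i $ j = 0}"
  have "\<h> \<subseteq> ?T"
  proof safe
    fix H i j assume H: "H \<in> \<h>" and ij: "i \<noteq> (j::'n)"
    have "v j \<in> ?V" using v E(1) by (auto simp: bij_betw_def)
    then obtain c where c: "H *v v j = c *s v j" using joint[OF _ H] by blast
    have "(H ** P) $ k $ j = c * P $ k $ j" for k
    proof -
      have "(H ** P) $ k $ j = (H *v v j) $ k"
        by (simp add: matrix_matrix_mult_def matrix_vector_mult_def P_def)
      then show ?thesis by (simp add: c P_def)
    qed
    then have "(Q ** (H ** P)) $ i $ j = c * (Q ** P) $ i $ j"
      by (simp add: matrix_matrix_mult_def[of Q] sum_distrib_left algebra_simps)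
    then show "(Q ** H ** P) $ i $ j = 0" using ij by (simp add: matrix_mul_assoc QP) (simp add: mat_def)
  qed (use abel in auto)
  moreover have "abelian_subalgebra ?T"
  proof -
    have "bracket X Y = 0" if "X \<in> ?T" "Y \<in> ?T" for X Y
    proof -
      let ?x = "Q ** X ** P" and ?y = "Q ** Y ** P"
      have diag: "(A ** B) $ i $ j = (if i = j then A $ i $ i * B $ i $ i else 0)"
        if "\<forall>i j. i \<noteq> j \<longrightarrow> A $ i $ j = 0" "\<forall>i j. i \<noteq> j \<longrightarrow> B $ i $ j = 0" for A B :: "complex ^ 'n ^ 'n" and i j
      proof -
        have "(A ** B) $ i $ j = (\<Sum>k\<in>UNIV. if k = i then (if i = j then A $ i $ i * B $ i $ i else 0) else 0)"
          unfolding matrix_matrix_mult_def vec_lambda_beta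
          by (rule sum.cong) (use that in auto)
        then show ?thesis by simp
      qed
      have "?x ** ?y = ?y ** ?x" using that by (simp add: vec_eq_iff diag)
      then have "P ** (?x ** ?y) ** Q = P ** (?y ** ?x) ** Q" by simp
      moreover have "P ** ((Q ** A ** P) ** (Q ** B ** P)) ** Q = A ** B" for A B
        by (metis PQ matrix_mul_assoc matrix_mul_lid matrix_mul_rid)
      ultimately show ?thesis by (simp add: bracket_def)
    qed
    moreover have "msp.subspace ?T"
      using subspace_sl by (auto simp: msp.subspace_def matrix_distribs)
    ultimately show ?thesis by (auto simp: abelian_subalgebra_def)
  qed
  ultimately have "?T = \<h>" by (intro maxi)
  then show thesis by (intro that[OF PQ QP]) (rule sym)
qed


section \<open>The root system of a diagonalised Cartan subalgebra\<close>

text \<open>The torus of trace-free matrices that become diagonal after the change of basis by \<open>P\<close>.\<close>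

locale diagonal_torus =
  fixes P Q :: "complex ^ 'n ^ 'n" and \<h> :: "(complex ^ 'n ^ 'n) set"
  assumes PQ: "P ** Q = mat 1" and QP: "Q ** P = mat 1"
    and torus_eq: "\<h> = {Z \<in> sl. \<forall>i j. i \<noteq> j \<longrightarrow> (Q ** Z ** P) $ i $ j = 0}"
begin

text \<open>Entries of a matrix with respect to the basis given by the columns of \<open>P\<close>, the matrix units
  of that basis, and the differences of coordinate functionals on the torus.\<close>

definition entry :: "complex ^ 'n ^ 'n \<Rightarrow> 'n \<Rightarrow> 'n \<Rightarrow> complex"
  where "entry Z i j = (Q ** Z ** P) $ i $ j"

definition E :: "'n \<Rightarrow> 'n \<Rightarrow> complex ^ 'n ^ 'n"
  where "E i j = P ** munit i j ** Q"

definition rt :: "'n \<Rightarrow> 'n \<Rightarrow> complex ^ 'n ^ 'n \<Rightarrow> complex"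
  where "rt i j = (\<lambda>X. if X \<in> \<h> then entry X i i - entry X j j else 0)"

lemma matrix_of_entries: "P ** (Q ** Z ** P) ** Q = Z"
  by (metis PQ matrix_mul_assoc matrix_mul_lid matrix_mul_rid)

lemma entry_eqI: "(\<And>i j. entry Z i j = entry W i j) \<Longrightarrow> Z = W"
  by (metis (mono_tags) entry_def matrix_of_entries vec_eq_iff)

lemma entry_linear [simp]:
  "entry (Z + W) i j = entry Z i j + entry W i j" "entry (Z - W) i j = entry Z i j - entry W i j"
  "entry (c *\<^sub>m Z) i j = c * entry Z i j" "entry (- Z) i j = - entry Z i j" "entry 0 i j = 0"
  by (simp_all add: entry_def matrix_distribs matrix_uminus_left matrix_uminus_right)

lemma entry_E: "entry (E i j) k l = (if k = i \<and> l = j then 1 else 0)"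
proof -
  have "Q ** E i j ** P = munit i j"
    unfolding E_def by (metis QP matrix_mul_assoc matrix_mul_lid matrix_mul_rid)
  then show ?thesis by (simp add: entry_def munit_nth)
qed

lemma E_mult_E: "E i j ** E k l = (if j = k then E i l else 0)"
proof -
  have "E i j ** E k l = P ** (munit i j ** munit k l) ** Q"
    unfolding E_def by (metis QP matrix_mul_assoc matrix_mul_rid)
  then show ?thesis by (simp add: munit_mult_munit E_def)
qed

lemma trace_eq_sum_entries: "trace Z = (\<Sum>i\<in>UNIV. entry Z i i)"
proof -
  have "trace Z = trace (Z ** P ** Q)" by (metis PQ matrix_mul_assoc matrix_mul_rid)
  also have "\<dots> = trace (Q ** (Z ** P))" by (rule trace_mul_sym)
  finally show ?thesis by (simp add: entry_def trace_def matrix_mul_assoc)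
qed

lemma torus_iff: "X \<in> \<h> \<longleftrightarrow> X \<in> sl \<and> (\<forall>i j. i \<noteq> j \<longrightarrow> entry X i j = 0)"
  by (simp add: torus_eq entry_def)

lemma torus_sl: "X \<in> \<h> \<Longrightarrow> X \<in> sl"
  by (simp add: torus_iff)

lemma torus_subspace: "msp.subspace \<h>"
  using subspace_sl by (auto simp: msp.subspace_def torus_iff)

lemma E_sl: "i \<noteq> j \<Longrightarrow> E i j \<in> sl"
  by (auto simp: sl_def trace_eq_sum_entries entry_E intro!: sum.neutral)

lemma coroot_torus: "E i i - E j j \<in> \<h>"
  by (simp add: torus_iff sl_def trace_eq_sum_entries entry_E sum_subtractf)

lemma entry_torus_mult:
  assumes "H \<in> \<h>"
  shows "entry (H ** X) i j = entry H i i * entry X i j" "entry (X ** H) i j = entry X i j * entry H j j"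
proof -
  have H: "entry H k l = 0" if "k \<noteq> l" for k l using assms that by (auto simp: torus_iff)
  have prod: "entry (A ** B) i j = (\<Sum>k\<in>UNIV. entry A i k * entry B k j)" for A B
  proof -
    have "Q ** (A ** B) ** P = (Q ** A ** P) ** (Q ** B ** P)"
      by (metis PQ matrix_mul_assoc matrix_mul_rid)
    then show ?thesis by (simp add: entry_def matrix_matrix_mult_def[of "Q ** A ** P"])
  qed
  have "entry (H ** X) i j = (\<Sum>k\<in>UNIV. if k = i then entry H i i * entry X i j else 0)"
    unfolding prod by (rule sum.cong) (auto simp: H)
  then show "entry (H ** X) i j = entry H i i * entry X i j" by simp
  have "entry (X ** H) i j = (\<Sum>k\<in>UNIV. if k = j then entry X i j * entry H j j else 0)"
    unfolding prod by (rule sum.cong) (auto simp: H)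
  then show "entry (X ** H) i j = entry X i j * entry H j j" by simp
qed

lemma entry_bracket_torus:
  "H \<in> \<h> \<Longrightarrow> entry (bracket H X) i j = rt i j H * entry X i j"
  by (simp add: bracket_def entry_torus_mult rt_def algebra_simps)

lemma rt_coroot: "rt i j (E k k - E l l) =
    (if i = k then 1 else 0) - (if i = l then 1 else 0) - (if j = k then 1 else 0) + (if j = l then 1 else 0)"
  using coroot_torus[of k l] by (auto simp: rt_def entry_E)

text \<open>Among the differences \<open>E i i - E j j\<close>, the functional \<open>rt k l\<close> takes the value \<open>2\<close> only at
  \<open>E k k - E l l\<close>.\<close>

lemma rt_inject:
  assumes "i \<noteq> j" "k \<noteq> l" "rt i j = rt k l" shows "i = k \<and> j = l"
proof -
  have "rt k l (E i i - E j j) = 2" using assms(1) by (simp flip: assms(3) add: rt_coroot)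
  then show ?thesis using assms by (auto simp: rt_coroot split: if_splits)
qed

lemma root_space_entry:
  assumes "X \<in> root_space \<h> \<phi>" "entry X i j \<noteq> 0" "H \<in> \<h>"
  shows "\<phi> H = rt i j H"
proof -
  have "bracket H X = \<phi> H *\<^sub>m X" using assms by (simp add: root_space_def)
  then have "rt i j H * entry X i j = \<phi> H * entry X i j"
    using entry_bracket_torus[OF assms(3), of X i j] by (metis entry_linear(3))
  then show ?thesis using assms(2) by auto
qed

lemma root_space_entry_eq:
  assumes "\<phi> \<in> roots \<h>" "X \<in> root_space \<h> \<phi>" "entry X i j \<noteq> 0"
  shows "\<phi> = rt i j"
proof
  fix H
  have "\<phi> H = 0" if "H \<notin> \<h>" using assms(1) that by (simp add: roots_def dual_space_def)
  then show "\<phi> H = rt i j H"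
    using root_space_entry[OF assms(2,3), of H] by (cases "H \<in> \<h>") (simp_all add: rt_def)
qed

lemma E_root_space: "i \<noteq> j \<Longrightarrow> E i j \<in> root_space \<h> (rt i j)"
  unfolding root_space_def
  by (auto simp: E_sl intro!: entry_eqI) (auto simp: entry_bracket_torus entry_E)

lemma rt_in_roots:
  assumes "i \<noteq> j" shows "rt i j \<in> roots \<h>"
proof -
  have "rt i j (E i i - E j j) = 2" using assms by (simp add: rt_coroot)
  then have "rt i j \<noteq> (\<lambda>X. 0)" by auto
  moreover have "E i j \<noteq> 0" using entry_E[of i j i j] by auto
  then have "root_space \<h> (rt i j) \<noteq> {0}" using E_root_space[OF assms] by auto
  moreover have "rt i j \<in> dual_space \<h>"
    using torus_subspace by (auto simp: dual_space_def mfunctional_on_def rt_def msp.subspace_def algebra_simps)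
  ultimately show ?thesis by (simp add: roots_def)
qed

lemma root_cases:
  assumes "\<phi> \<in> roots \<h>" obtains i j where "i \<noteq> j" "\<phi> = rt i j"
proof -
  obtain X where X: "X \<in> root_space \<h> \<phi>" "X \<noteq> 0"
  proof -
    have "0 \<in> root_space \<h> \<phi>" using msp.subspace_0[OF subspace_sl] by (simp add: root_space_def)
    then show thesis using assms that by (auto simp: roots_def)
  qed
  then obtain i j where ij: "entry X i j \<noteq> 0" using entry_eqI[of X 0] by auto
  have "\<phi> = rt i j" by (rule root_space_entry_eq[OF assms X(1) ij])
  moreover have "i \<noteq> j" using assms calculation by (auto simp: roots_def rt_def)
  ultimately show thesis using that by blast
qed

lemma finite_roots: "finite (roots \<h>)"
proof (rule finite_subset)
  show "roots \<h> \<subseteq> (\<lambda>(i, j). rt i j) ` UNIV" by (auto elim!: root_cases)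
qed simp

lemma root_space_rt:
  assumes "i \<noteq> j" "X \<in> root_space \<h> (rt i j)" shows "X = entry X i j *\<^sub>m E i j"
proof (rule entry_eqI)
  fix k l
  have "entry X k l = 0" if "(k, l) \<noteq> (i, j)"
  proof (rule ccontr)
    assume ne: "entry X k l \<noteq> 0"
    have "rt i j = rt k l" by (rule root_space_entry_eq[OF rt_in_roots[OF assms(1)] assms(2) ne])
    moreover have "k \<noteq> l"
    proof
      assume "k = l"
      then have "rt i j (E i i - E j j) = 0" using calculation by (simp add: rt_def)
      then show False using assms(1) by (simp add: rt_coroot)
    qed
    ultimately show False using rt_inject assms(1) that by blast
  qed
  then show "entry X k l = entry (entry X i j *\<^sub>m E i j) k l" by (auto simp: entry_E)
qed

lemma killing_torus:
  assumes "H \<in> \<h>" "K \<in> \<h>"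
  shows "killing H K = 2 * of_nat CARD('n) * (\<Sum>i\<in>UNIV. entry H i i * entry K i i)"
  using assms by (simp add: killing_eq torus_sl trace_eq_sum_entries entry_torus_mult(1))

lemma killing_torus_nondegenerate:
  assumes K: "K \<in> \<h>" and zero: "\<And>H. H \<in> \<h> \<Longrightarrow> killing H K = 0" shows "K = 0"
proof -
  have eq: "entry K k k = entry K l l" for k l
  proof -
    have "(\<Sum>i\<in>UNIV. entry (E k k - E l l) i i * entry K i i) =
        (\<Sum>i\<in>UNIV. (if i = k then entry K k k else 0) - (if i = l then entry K l l else 0))"
      by (rule sum.cong) (auto simp: entry_E)
    then show ?thesis
      using zero[OF coroot_torus, of k l] by (simp add: killing_torus[OF coroot_torus K] sum_subtractf)
  qed
  have "entry K k k = 0" for k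
  proof -
    have "0 = (\<Sum>i\<in>UNIV. entry K i i)" using torus_sl[OF K] by (simp add: sl_def trace_eq_sum_entries)
    also have "\<dots> = (\<Sum>i\<in>(UNIV :: 'n set). entry K k k)" by (rule sum.cong) (auto intro: eq)
    finally show ?thesis by simp
  qed
  then show ?thesis using K by (intro entry_eqI) (metis entry_linear(5) torus_iff)
qed

lemma killing_dual_eqI:
  assumes "K \<in> \<h>" "\<And>H. H \<in> \<h> \<Longrightarrow> killing H K = \<phi> H"
  shows "killing_dual \<h> \<phi> = K"
  unfolding killing_dual_def
proof (rule the_equality)
  show "K \<in> \<h> \<and> (\<forall>H\<in>\<h>. killing H K = \<phi> H)" using assms by blast
  fix K' assume K': "K' \<in> \<h> \<and> (\<forall>H\<in>\<h>. killing H K' = \<phi> H)"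
  have "K' - K \<in> \<h>" using K' assms(1) by (intro msp.subspace_diff torus_subspace) auto
  moreover have "killing H (K' - K) = 0" if "H \<in> \<h>" for H
  proof -
    have "killing H (K' - K) = killing H K' - killing H K"
      using that K' assms(1) calculation by (simp add: killing_torus sum_subtractf right_diff_distrib)
    then show ?thesis using that K' assms(2) by simp
  qed
  ultimately have "K' - K = 0" by (rule killing_torus_nondegenerate)
  then show "K' = K" by simp
qed

lemma killing_dual_rt: "killing_dual \<h> (rt i j) = (1 / (2 * of_nat CARD('n))) *\<^sub>m (E i i - E j j)"
proof (rule killing_dual_eqI)
  show "(1 / (2 * of_nat CARD('n))) *\<^sub>m (E i i - E j j) \<in> \<h>" (is "?K \<in> \<h>")
    by (intro msp.subspace_scale torus_subspace coroot_torus)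
  fix H assume H: "H \<in> \<h>"
  have "(\<Sum>k\<in>UNIV. entry H k k * entry ?K k k) = (\<Sum>k\<in>UNIV. (1 / (2 * of_nat CARD('n))) *
      ((if k = i then entry H i i else 0) - (if k = j then entry H j j else 0)))"
    by (rule sum.cong) (auto simp: entry_E)
  also have "\<dots> = (1 / (2 * of_nat CARD('n))) * (entry H i i - entry H j j)"
    by (simp only: sum_distrib_left[symmetric] sum_subtractf) simp
  finally show "killing H ?K = rt i j H"
    using H \<open>?K \<in> \<h>\<close> by (simp only: killing_torus) (simp add: rt_def)
qed

lemma killing_dual_torus: "\<phi> \<in> roots \<h> \<Longrightarrow> killing_dual \<h> \<phi> \<in> \<h>"
  by (elim root_cases) (auto simp: killing_dual_rt intro: msp.subspace_scale torus_subspace coroot_torus)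

lemma root_inner_rt: "root_inner \<h> (rt i j) (rt k l) = rt i j (E k k - E l l) / (2 * of_nat CARD('n))"
proof -
  let ?c = "1 / (2 * complex_of_nat CARD('n))"
  have in_h: "c *\<^sub>m (E i i - E j j) \<in> \<h>" for c i j
    by (intro msp.subspace_scale torus_subspace coroot_torus)
  have "(\<Sum>p\<in>UNIV. entry (?c *\<^sub>m (E i i - E j j)) p p * entry (?c *\<^sub>m (E k k - E l l)) p p) =
      (\<Sum>p\<in>UNIV. ?c * ?c * ((if p = i then entry (E k k - E l l) i i else 0) -
        (if p = j then entry (E k k - E l l) j j else 0)))"
    by (rule sum.cong) (auto simp: entry_E)
  also have "\<dots> = ?c * ?c * rt i j (E k k - E l l)"
    using coroot_torus[of k l] by (simp only: sum_distrib_left[symmetric] sum_subtractf) (simp add: rt_def)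
  finally show ?thesis
    by (simp add: root_inner_def killing_dual_rt killing_torus[OF in_h in_h] del: entry_linear)
qed

end


section \<open>Positive roots and the conjugation\<close>

lemma lex_positive_add:
  assumes "lex_positive Hs \<phi>" "lex_positive Hs \<psi>" shows "lex_positive Hs (root_add \<phi> \<psi>)"
proof -
  obtain i where i: "i < length Hs" "\<forall>j<i. \<phi> (Hs ! j) = 0" "Re (\<phi> (Hs ! i)) > 0"
    using assms(1) by (auto simp: lex_positive_def)
  obtain k where k: "k < length Hs" "\<forall>j<k. \<psi> (Hs ! j) = 0" "Re (\<psi> (Hs ! k)) > 0"
    using assms(2) by (auto simp: lex_positive_def)
  have "Re (\<phi> (Hs ! min i k) + \<psi> (Hs ! min i k)) > 0"
    using i k by (cases i k rule: linorder_cases) (auto simp: min_def)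
  then show ?thesis
    using i k by (auto simp: lex_positive_def root_add_def intro!: exI[of _ "min i k"])
qed

text \<open>The negative of a functional.\<close>

definition root_neg :: "('v \<Rightarrow> complex) \<Rightarrow> 'v \<Rightarrow> complex"
  where "root_neg \<phi> = (\<lambda>X. - \<phi> X)"

text \<open>The action of the conjugation on functionals; the conjugation maps the root space of \<open>\<phi>\<close> to
  that of \<open>root_conj \<phi>\<close>.\<close>

definition root_conj :: "(complex ^ 'n ^ 'n \<Rightarrow> complex) \<Rightarrow> complex ^ 'n ^ 'n \<Rightarrow> complex"
  where "root_conj \<phi> = (\<lambda>X. cnj (\<phi> (conj_mat X)))"

lemma root_neg_neg [simp]: "root_neg (root_neg \<phi>) = \<phi>"
  by (simp add: root_neg_def)

lemma root_conj_conj [simp]: "root_conj (root_conj \<phi>) = \<phi>"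
  by (simp add: root_conj_def)

lemma root_neg_conj: "root_neg (root_conj \<phi>) = root_conj (root_neg \<phi>)"
  by (simp add: root_neg_def root_conj_def)

lemma root_neg_add: "root_neg (root_add \<phi> \<psi>) = root_add (root_neg \<phi>) (root_neg \<psi>)"
  and root_conj_add: "root_conj (root_add \<phi> \<psi>) = root_add (root_conj \<phi>) (root_conj \<psi>)"
  by (simp_all add: root_neg_def root_conj_def root_add_def)

lemma lex_positive_not_neg: "lex_positive Hs \<phi> \<Longrightarrow> \<not> lex_positive Hs (root_neg \<phi>)"
  unfolding lex_positive_def root_neg_def
  by (metis (no_types, lifting) linorder_neqE_nat neg_equal_0_iff_equal less_irrefl neg_0_less_iff_less
      not_less_iff_gr_or_eq uminus_complex.simps(1) zero_complex.simps(1))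

text \<open>An injective self-map of the path \<open>1 - 2 - \<dots> - r\<close> that maps neighbours to neighbours
  cannot turn back, so it is the identity or the reversal.\<close>

lemma path_automorphism:
  fixes f :: "nat \<Rightarrow> nat"
  assumes inj: "inj_on f {1..r}" and into: "f ` {1..r} \<subseteq> {1..r}"
    and adj: "\<And>i. 1 \<le> i \<Longrightarrow> Suc i \<le> r \<Longrightarrow> f i = Suc (f (Suc i)) \<or> f (Suc i) = Suc (f i)"
  shows "(\<forall>i\<in>{1..r}. f i = i) \<or> (\<forall>i\<in>{1..r}. f i = Suc r - i)"
proof (cases "r \<ge> 2")
  case False
  then have "r = 0 \<or> r = 1" by linarith
  then show ?thesis using into by auto
next
  case True
  have rng: "1 \<le> f i \<and> f i \<le> r" if "1 \<le> i" "i \<le> r" for i using into that by fastforce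
  have two: "1 \<le> i \<Longrightarrow> Suc (Suc i) \<le> r \<Longrightarrow> f (Suc (Suc i)) \<noteq> f i" for i
    using inj_onD[OF inj, of "Suc (Suc i)" i] by auto
  consider "f 2 = Suc (f 1)" | "f 1 = Suc (f 2)" using adj[of 1] True by (auto simp: numeral_2_eq_2)
  then show ?thesis
  proof cases
    case 1
    have mono: "1 \<le> i \<Longrightarrow> Suc i \<le> r \<Longrightarrow> f i + 1 = f (Suc i)" for i
    proof (induction i rule: dec_induct[of 1])
      case base then show ?case using 1 by (simp add: numeral_2_eq_2)
    next
      case (step n) then show ?case using adj[of "Suc n"] two[of n] by auto
    qed
    have "i \<le> r \<Longrightarrow> f i + 1 = f 1 + i" if "1 \<le> i" for i
      using that
    proof (induction i rule: dec_induct)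
      case (step n)
      then show ?case using mono[of n] by simp
    qed simp
    then have "f i + 1 = f 1 + i" if "i \<in> {1..r}" for i using that by simp
    moreover have "f 1 = 1" using calculation[of r] rng[of r] rng[of 1] True by simp
    ultimately show ?thesis by auto
  next
    case 2
    have mono: "1 \<le> i \<Longrightarrow> Suc i \<le> r \<Longrightarrow> f i = f (Suc i) + 1" for i
    proof (induction i rule: dec_induct[of 1])
      case base then show ?case using 2 by (simp add: numeral_2_eq_2)
    next
      case (step n) then show ?case using adj[of "Suc n"] two[of n] by auto
    qed
    have "i \<le> r \<Longrightarrow> f i + i = f 1 + 1" if "1 \<le> i" for i
      using that
    proof (induction i rule: dec_induct)
      case (step n)
      then show ?case using mono[of n] by simp
    qed simp
    then have "f i + i = f 1 + 1" if "i \<in> {1..r}" for i using that by simp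
    moreover have "f 1 = r" using calculation[of r] rng[of r] rng[of 1] True by simp
    ultimately show ?thesis by fastforce
  qed
qed

text \<open>A diagonalised torus that is stable under the conjugation.\<close>

locale real_torus = diagonal_torus P Q \<h> for P Q :: "complex ^ 'n ^ 'n" and \<h> +
  assumes conj_torus: "X \<in> \<h> \<Longrightarrow> conj_mat X \<in> \<h>"
begin

lemma conj_torus_iff: "conj_mat X \<in> \<h> \<longleftrightarrow> X \<in> \<h>"
  using conj_torus[of X] conj_torus[of "conj_mat X"] by auto

lemma conj_root_space:
  assumes "X \<in> root_space \<h> \<phi>" shows "conj_mat X \<in> root_space \<h> (root_conj \<phi>)"
proof -
  have "bracket H (conj_mat X) = root_conj \<phi> H *\<^sub>m conj_mat X" if "H \<in> \<h>" for H
  proof -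
    have "bracket H (conj_mat X) = conj_mat (bracket (conj_mat H) X)" by (simp add: conj_mat_bracket)
    also have "\<dots> = conj_mat (\<phi> (conj_mat H) *\<^sub>m X)"
      using assms conj_torus[OF that] by (simp add: root_space_def)
    finally show ?thesis by (simp add: conj_mat_mscale root_conj_def)
  qed
  then show ?thesis using assms by (simp add: root_space_def)
qed

lemma root_neg_rt: "root_neg (rt i j) = rt j i"
  by (auto simp: root_neg_def rt_def)

lemma root_neg_roots: "\<phi> \<in> roots \<h> \<Longrightarrow> root_neg \<phi> \<in> roots \<h>"
  by (metis root_cases root_neg_rt rt_in_roots)

lemma root_conj_roots:
  assumes "\<phi> \<in> roots \<h>" shows "root_conj \<phi> \<in> roots \<h>"
proof -
  obtain i j where ij: "i \<noteq> j" "\<phi> = rt i j" using assms by (rule root_cases)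
  have E: "conj_mat (E i j) \<in> root_space \<h> (root_conj \<phi>)"
    unfolding ij(2) by (intro conj_root_space E_root_space ij(1))
  have "conj_mat (E i j) \<noteq> 0"
    by (metis conj_mat_conj_mat conj_mat_zero entry_E entry_linear(5) one_neq_zero)
  then have "root_space \<h> (root_conj \<phi>) \<noteq> {0}" using E by auto
  moreover have "root_conj \<phi> \<in> dual_space \<h>"
    using assms by (auto simp: roots_def dual_space_def mfunctional_on_def root_conj_def conj_torus_iff
        conj_mat_add conj_mat_mscale)
  moreover have "root_conj \<phi> \<noteq> (\<lambda>X. 0)"
  proof
    assume "root_conj \<phi> = (\<lambda>X. 0)"
    then have "root_conj (root_conj \<phi>) = (\<lambda>X. 0)" by (simp add: root_conj_def)
    then show False using assms by (simp add: roots_def)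
  qed
  ultimately show ?thesis by (simp add: roots_def)
qed

lemma killing_dual_spec:
  assumes "\<phi> \<in> roots \<h>" "H \<in> \<h>" shows "killing H (killing_dual \<h> \<phi>) = \<phi> H"
proof -
  obtain i j where ij: "i \<noteq> j" "\<phi> = rt i j" using assms(1) by (rule root_cases)
  have "(\<Sum>k\<in>UNIV. entry H k k * entry (killing_dual \<h> \<phi>) k k) =
      (\<Sum>k\<in>UNIV. (1 / (2 * of_nat CARD('n))) *
        ((if k = i then entry H i i else 0) - (if k = j then entry H j j else 0)))"
    by (rule sum.cong) (auto simp: ij killing_dual_rt entry_E)
  also have "\<dots> = (1 / (2 * of_nat CARD('n))) * (entry H i i - entry H j j)"
    by (simp only: sum_distrib_left[symmetric] sum_subtractf) simp
  finally show ?thesis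
    using assms killing_dual_torus[OF assms(1)] ij by (simp only: killing_torus) (simp add: rt_def)
qed

lemma killing_dual_conj_neg:
  assumes "\<phi> \<in> roots \<h>"
  shows "killing_dual \<h> (root_neg (root_conj \<phi>)) = - conj_mat (killing_dual \<h> \<phi>)" (is "_ = - conj_mat ?K")
proof (rule killing_dual_eqI)
  have K: "?K \<in> \<h>" by (rule killing_dual_torus[OF assms])
  then show "- conj_mat ?K \<in> \<h>" by (intro msp.subspace_neg torus_subspace conj_torus)
  fix H assume H: "H \<in> \<h>"
  have "killing H (- conj_mat ?K) = - killing (conj_mat (conj_mat H)) (conj_mat ?K)"
    using H K conj_torus[OF K] msp.subspace_neg[OF torus_subspace conj_torus[OF K]]
    by (simp add: killing_torus sum_negf)
  also have "\<dots> = - cnj (killing (conj_mat H) ?K)"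
    by (subst killing_conj_mat) (use H K torus_sl conj_torus in auto)
  also have "\<dots> = root_neg (root_conj \<phi>) H"
    by (simp add: killing_dual_spec[OF assms conj_torus[OF H]] root_neg_def root_conj_def)
  finally show "killing H (- conj_mat ?K) = root_neg (root_conj \<phi>) H" .
qed

end


section \<open>The conjugation reverses the Dynkin diagram\<close>

text \<open>The situation of a Cartan subalgebra with a choice of positive roots, labelled simple roots and
  root vectors, such that \<open>sl(n,\<complex>)\<close> is the direct sum of the associated subspace \<open>\<q>\<close> and its
  conjugate.\<close>

locale root_data = real_torus P Q \<h> for P Q :: "complex ^ 'n ^ 'n" and \<h> +
  fixes Hs :: "(complex ^ 'n ^ 'n) list" and m :: nat
    and \<alpha> :: "nat \<Rightarrow> complex ^ 'n ^ 'n \<Rightarrow> complex"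
    and e :: "(complex ^ 'n ^ 'n \<Rightarrow> complex) \<Rightarrow> complex ^ 'n ^ 'n"
    and \<q> :: "(complex ^ 'n ^ 'n) set"
  assumes m: "m \<ge> 2"
    and labelling: "standard_labelling \<h> Hs (2 * m - 2) \<alpha>"
    and generators: "\<And>\<beta>. \<beta> \<in> pos_roots \<h> Hs \<Longrightarrow> e \<beta> \<in> root_space \<h> \<beta> \<and> e \<beta> \<noteq> 0"
    and q_eq: "\<q> = q_algebra \<h> Hs m \<alpha> e"
    and decomposition: "\<And>Z. Z \<in> sl \<Longrightarrow> \<exists>A B. A \<in> \<q> \<and> B \<in> \<q> \<and> Z = A + conj_mat B"
    and direct: "\<And>Z. Z \<in> \<q> \<Longrightarrow> conj_mat Z \<in> \<q> \<Longrightarrow> Z = 0"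
begin

abbreviation pos :: "(complex ^ 'n ^ 'n \<Rightarrow> complex) set" where "pos \<equiv> pos_roots \<h> Hs"

lemma pos_roots_subset: "pos \<subseteq> roots \<h>"
  by (auto simp: pos_roots_def)

lemma label_pos: "i \<in> {1..2*m-2} \<Longrightarrow> \<alpha> i \<in> pos"
proof -
  assume "i \<in> {1..2*m-2}"
  then have "\<alpha> i \<in> simple_roots \<h> Hs" using labelling by (metis standard_labelling_def bij_betw_apply)
  then show ?thesis by (simp add: simple_roots_def)
qed

lemma label_root: "i \<in> {1..2*m-2} \<Longrightarrow> \<alpha> i \<in> roots \<h>"
  using label_pos pos_roots_subset by blast

lemma middle_labels: "m - 1 \<in> {1..2*m-2}" "m \<in> {1..2*m-2}"
  using m by auto

lemma label_inject: "i \<in> {1..2*m-2} \<Longrightarrow> j \<in> {1..2*m-2} \<Longrightarrow> \<alpha> i = \<alpha> j \<longleftrightarrow> i = j"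
  using labelling by (auto simp: standard_labelling_def bij_betw_def inj_on_def)

lemma H_tilde_torus:
  assumes "k \<in> {1..m-1}" shows "H_tilde \<h> m \<alpha> k \<in> \<h>"
proof -
  have "killing_dual \<h> (\<alpha> i) \<in> \<h>" if "i \<in> {1..2*m-2}" for i
    by (rule killing_dual_torus[OF label_root[OF that]])
  moreover have "2 * m - 1 - k \<in> {1..2*m-2}" "k \<in> {1..2*m-2}" using assms by auto
  moreover have "m - 2 \<in> {1..2*m-2}" if "k = m - 2" using assms that by auto
  ultimately show ?thesis
    using middle_labels unfolding H_tilde_def Let_def
    by (auto simp del: One_nat_def intro!: msp.subspace_add msp.subspace_diff msp.subspace_scale torus_subspace)
qed

text \<open>All weights of \<open>\<q>\<close> and of its conjugate are zero, positive roots or conjugates of positive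
  roots, and \<open>sl(n,\<complex>)\<close> is the sum of these two subspaces.\<close>

lemma root_pos_or_conj_pos:
  assumes "\<phi> \<in> roots \<h>" shows "\<phi> \<in> pos \<union> root_conj ` pos"
proof (rule ccontr)
  assume neg: "\<phi> \<notin> pos \<union> root_conj ` pos"
  obtain i j where ij: "i \<noteq> j" "\<phi> = rt i j" using assms by (rule root_cases)
  let ?N = "{Z. entry Z i j = 0 \<and> entry (conj_mat Z) i j = 0}"
  have sub: "msp.subspace ?N"
    by (auto simp: msp.subspace_def conj_mat_add conj_mat_mscale)
  have weight: "entry X i j = 0" if "X \<in> root_space \<h> \<beta>" "\<beta> \<in> pos \<union> root_conj ` pos" for X \<beta>
  proof (rule ccontr)
    assume "entry X i j \<noteq> 0"
    moreover have "\<beta> \<in> roots \<h>" using that(2) pos_roots_subset root_conj_roots by auto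
    ultimately have "\<beta> = \<phi>" using root_space_entry_eq[OF _ that(1)] ij(2) by blast
    then show False using neg that(2) by blast
  qed
  have torus: "X \<in> ?N" if "X \<in> \<h>" for X
    using that conj_torus[OF that] ij(1) by (simp add: torus_iff)
  have vector: "X \<in> ?N" if "X \<in> root_space \<h> \<beta>" "\<beta> \<in> pos" for X \<beta>
    using weight[OF that(1)] weight[OF conj_root_space[OF that(1)]] that(2) by blast
  have conj: "conj_mat X \<in> ?N" if "X \<in> ?N" for X using that by simp
  have "e (\<alpha> (m - 1)) + conj_mat (e (\<alpha> m)) \<in> ?N"
    using generators label_pos middle_labels
    by (intro msp.subspace_add[OF sub] conj vector) auto
  then have "\<q> \<subseteq> ?N"
    unfolding q_eq q_algebra_def
    using torus[OF H_tilde_torus] vector generators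
    by (intro msp.span_minimal[OF _ sub]) blast
  moreover obtain A B where "A \<in> \<q>" "B \<in> \<q>" "E i j = A + conj_mat B"
    using decomposition[OF E_sl[OF ij(1)]] by blast
  ultimately have "entry A i j = 0" "entry (conj_mat B) i j = 0" by blast+
  then have "entry (E i j) i j = 0" using \<open>E i j = A + conj_mat B\<close> by simp
  then show False by (simp add: entry_E)
qed

text \<open>The positive roots are disjoint from their negatives and, together with their conjugates,
  exhaust all roots. Hence exactly half of the roots are positive, and the conjugation exchanges
  positive and negative roots.\<close>

lemma root_signs: "roots \<h> = pos \<union> root_neg ` pos" "pos \<inter> root_conj ` pos = {}"
proof -
  have fin: "finite pos" using finite_subset[OF pos_roots_subset finite_roots] .
  have inj: "inj_on root_neg pos" "inj_on root_conj pos"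
    by (metis inj_onI root_neg_neg, metis inj_onI root_conj_conj)
  have disj: "pos \<inter> root_neg ` pos = {}"
    using lex_positive_not_neg by (auto simp: pos_roots_def)
  have subset: "pos \<union> root_neg ` pos \<subseteq> roots \<h>"
    using pos_roots_subset root_neg_roots by auto
  have card_neg: "card (pos \<union> root_neg ` pos) = 2 * card pos"
    using fin disj inj by (simp add: card_Un_disjoint card_image)
  have union: "pos \<union> root_conj ` pos = roots \<h>"
    using root_pos_or_conj_pos pos_roots_subset root_conj_roots by auto
  have card_conj: "card (pos \<union> root_conj ` pos) + card (pos \<inter> root_conj ` pos) = 2 * card pos"
    using card_Un_Int[of pos "root_conj ` pos"] fin inj by (simp add: card_image)
  have "2 * card pos \<le> card (roots \<h>)"
    using card_mono[OF finite_roots subset] card_neg by simp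
  then have "card (pos \<inter> root_conj ` pos) = 0" "card (roots \<h>) = 2 * card pos"
    using card_conj unfolding union by linarith+
  then show "pos \<inter> root_conj ` pos = {}" "roots \<h> = pos \<union> root_neg ` pos"
    using fin card_subset_eq[OF finite_roots subset] card_neg by auto
qed

text \<open>The involution \<open>- \<sigma>\<close> of the roots, which permutes the positive and hence the simple roots.\<close>

definition twist :: "(complex ^ 'n ^ 'n \<Rightarrow> complex) \<Rightarrow> complex ^ 'n ^ 'n \<Rightarrow> complex"
  where "twist \<phi> = root_neg (root_conj \<phi>)"

lemma twist_twist [simp]: "twist (twist \<phi>) = \<phi>"
  by (simp add: twist_def root_neg_conj)

lemma root_conj_eq: "root_conj \<phi> = root_neg (twist \<phi>)"
  by (simp add: twist_def)

lemma twist_add: "twist (root_add \<phi> \<psi>) = root_add (twist \<phi>) (twist \<psi>)"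
  by (simp add: twist_def root_conj_add root_neg_add)

lemma twist_pos:
  assumes "\<phi> \<in> pos" shows "twist \<phi> \<in> pos"
proof -
  have "root_conj \<phi> \<in> roots \<h>" "root_conj \<phi> \<notin> pos"
    using assms root_signs(2) pos_roots_subset root_conj_roots by auto
  then obtain \<psi> where "\<psi> \<in> pos" "root_conj \<phi> = root_neg \<psi>" using root_signs(1) by auto
  then show ?thesis by (simp add: twist_def)
qed

lemma twist_simple:
  assumes "\<phi> \<in> simple_roots \<h> Hs" shows "twist \<phi> \<in> simple_roots \<h> Hs"
proof -
  have "twist \<phi> \<noteq> root_add \<beta> \<gamma>" if "\<beta> \<in> pos" "\<gamma> \<in> pos" for \<beta> \<gamma>
  proof
    assume "twist \<phi> = root_add \<beta> \<gamma>"
    then have "\<phi> = root_add (twist \<beta>) (twist \<gamma>)" by (metis twist_add twist_twist)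
    then show False using assms that twist_pos by (auto simp: simple_roots_def)
  qed
  then show ?thesis using assms twist_pos by (auto simp: simple_roots_def)
qed

lemma pos_add:
  "\<phi> \<in> pos \<Longrightarrow> \<psi> \<in> pos \<Longrightarrow> root_add \<phi> \<psi> \<in> roots \<h> \<Longrightarrow> root_add \<phi> \<psi> \<in> pos"
  by (simp add: pos_roots_def lex_positive_add)

lemma killing_dual_twist:
  "\<phi> \<in> roots \<h> \<Longrightarrow> killing_dual \<h> (twist \<phi>) = - conj_mat (killing_dual \<h> \<phi>)"
  by (simp add: twist_def killing_dual_conj_neg)

lemma root_inner_twist:
  assumes "\<phi> \<in> roots \<h>" "\<psi> \<in> roots \<h>"
  shows "root_inner \<h> (twist \<phi>) (twist \<psi>) = cnj (root_inner \<h> \<phi> \<psi>)"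
proof -
  have sl: "killing_dual \<h> \<phi> \<in> sl" "killing_dual \<h> \<psi> \<in> sl"
    using assms killing_dual_torus torus_sl by auto
  have neg: "- conj_mat X \<in> sl" if "X \<in> sl" for X
    by (intro msp.subspace_neg subspace_sl) (simp add: that)
  have "root_inner \<h> (twist \<phi>) (twist \<psi>) =
      killing (- conj_mat (killing_dual \<h> \<phi>)) (- conj_mat (killing_dual \<h> \<psi>))"
    by (simp add: root_inner_def killing_dual_twist assms)
  also have "\<dots> = killing (conj_mat (killing_dual \<h> \<phi>)) (conj_mat (killing_dual \<h> \<psi>))"
    using sl by (simp add: killing_eq neg matrix_uminus_left matrix_uminus_right)
  finally show ?thesis using sl by (simp add: killing_conj_mat root_inner_def)
qed

lemma cartan_matrix:
  assumes "i \<in> {1..2*m-2}" "j \<in> {1..2*m-2}"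
  shows "2 * root_inner \<h> (\<alpha> i) (\<alpha> j) / root_inner \<h> (\<alpha> j) (\<alpha> j) =
    (if i = j then 2 else if i = Suc j \<or> j = Suc i then -1 else 0)"
  using labelling assms by (simp add: standard_labelling_def)

lemma root_norm:
  assumes "\<phi> \<in> roots \<h>" shows "root_inner \<h> \<phi> \<phi> = 1 / of_nat CARD('n)"
  using assms by (elim root_cases) (simp add: root_inner_rt rt_coroot)

lemma root_at_dual:
  assumes "\<phi> \<in> roots \<h>" "\<psi> \<in> roots \<h>"
  shows "\<phi> (killing_dual \<h> \<psi>) = root_inner \<h> \<psi> \<phi>"
  using killing_dual_spec[OF assms(1) killing_dual_torus[OF assms(2)]] by (simp add: root_inner_def)

lemma label_inner:
  assumes "i \<in> {1..2*m-2}" "j \<in> {1..2*m-2}"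
  shows "2 * of_nat CARD('n) * \<alpha> j (killing_dual \<h> (\<alpha> i)) =
    (if i = j then 2 else if i = Suc j \<or> j = Suc i then -1 else 0)"
  using cartan_matrix[OF assms] assms
  by (simp add: root_norm root_at_dual label_root algebra_simps)

lemma H_tilde_middle:
  "H_tilde \<h> m \<alpha> (m - 1) = killing_dual \<h> (\<alpha> (m - 1)) + 2 *\<^sub>m killing_dual \<h> (\<alpha> m)"
  by (simp add: H_tilde_def Let_def)

lemma H_tilde_middle_q: "H_tilde \<h> m \<alpha> (m - 1) \<in> \<q>"
  unfolding q_eq q_algebra_def using m by (intro msp.span_base UnI1 imageI) auto

lemma label_functional:
  assumes "i \<in> {1..2*m-2}"
  shows "X \<in> \<h> \<Longrightarrow> Y \<in> \<h> \<Longrightarrow> \<alpha> i (X + Y) = \<alpha> i X + \<alpha> i Y" "X \<in> \<h> \<Longrightarrow> \<alpha> i (c *\<^sub>m X) = c * \<alpha> i X"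
  using label_root[OF assms] by (auto simp: roots_def dual_space_def mfunctional_on_def)

text \<open>By the Cartan matrix the values are \<open>-1 + 2 * 2\<close> and \<open>2 + 2 * (-1)\<close>, up to the scaling of the
  Killing form.\<close>

lemma middle_at_H_tilde:
  "2 * of_nat CARD('n) * \<alpha> m (H_tilde \<h> m \<alpha> (m - 1)) = 3"
  "2 * of_nat CARD('n) * \<alpha> (m - 1) (H_tilde \<h> m \<alpha> (m - 1)) = 0"
proof -
  have dual: "killing_dual \<h> (\<alpha> i) \<in> \<h>" if "i \<in> {1..2*m-2}" for i
    by (rule killing_dual_torus[OF label_root[OF that]])
  have val: "\<alpha> j (H_tilde \<h> m \<alpha> (m - 1)) = \<alpha> j (killing_dual \<h> (\<alpha> (m - 1))) + 2 * \<alpha> j (killing_dual \<h> (\<alpha> m))"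
    if "j \<in> {1..2*m-2}" for j
    using dual[OF middle_labels(1)] dual[OF middle_labels(2)] that
    by (simp only: H_tilde_middle label_functional msp.subspace_scale[OF torus_subspace])
  have split: "2 * of_nat CARD('n) * \<alpha> j (H_tilde \<h> m \<alpha> (m - 1)) =
      2 * of_nat CARD('n) * \<alpha> j (killing_dual \<h> (\<alpha> (m - 1))) +
      2 * (2 * of_nat CARD('n) * \<alpha> j (killing_dual \<h> (\<alpha> m)))" if "j \<in> {1..2*m-2}" for j
    unfolding val[OF that] by (simp only: ring_distribs mult_ac)
  show "2 * of_nat CARD('n) * \<alpha> m (H_tilde \<h> m \<alpha> (m - 1)) = 3"
    unfolding split[OF middle_labels(2)] label_inner[OF middle_labels] label_inner[OF middle_labels(2,2)]
    using m by auto
  show "2 * of_nat CARD('n) * \<alpha> (m - 1) (H_tilde \<h> m \<alpha> (m - 1)) = 0"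
    unfolding split[OF middle_labels(1)] label_inner[OF middle_labels(1,1)] label_inner[OF middle_labels(2,1)]
    using m by auto
qed

text \<open>The diagram automorphism induced by \<open>- \<sigma>\<close> is not the identity: otherwise \<open>\<sigma>\<close> would map
  \<open>H_tilde\<close> to its negative, which lies in \<open>\<q>\<close>.\<close>

lemma twist_middle: "twist (\<alpha> m) = \<alpha> (m - 1)"
proof -
  let ?I = "{1..2*m-2}"
  have bij: "bij_betw \<alpha> ?I (simple_roots \<h> Hs)" using labelling by (simp add: standard_labelling_def)
  define f where "f = (\<lambda>i. inv_into ?I \<alpha> (twist (\<alpha> i)))"
  have f: "f i \<in> ?I" "\<alpha> (f i) = twist (\<alpha> i)" if "i \<in> ?I" for i
  proof -
    have "\<alpha> i \<in> simple_roots \<h> Hs" using bij that by (rule bij_betw_apply)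
    then have "twist (\<alpha> i) \<in> \<alpha> ` ?I" using bij twist_simple by (simp add: bij_betw_def)
    then show "f i \<in> ?I" "\<alpha> (f i) = twist (\<alpha> i)"
      unfolding f_def by (rule inv_into_into, rule f_inv_into_f)
  qed
  have "inj_on f ?I"
  proof (rule inj_onI)
    fix i j assume "i \<in> ?I" "j \<in> ?I" "f i = f j"
    then have "twist (\<alpha> i) = twist (\<alpha> j)" using f(2) by metis
    then show "i = j" using label_inject \<open>i \<in> ?I\<close> \<open>j \<in> ?I\<close> by (metis twist_twist)
  qed
  moreover have "f i = Suc (f (Suc i)) \<or> f (Suc i) = Suc (f i)" if "1 \<le> i" "Suc i \<le> 2*m-2" for i
  proof -
    have i: "i \<in> ?I" "Suc i \<in> ?I" using that by auto
    have "root_inner \<h> (\<alpha> (f i)) (\<alpha> (f (Suc i))) = cnj (root_inner \<h> (\<alpha> i) (\<alpha> (Suc i)))"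
      unfolding f(2)[OF i(1)] f(2)[OF i(2)] by (rule root_inner_twist[OF label_root label_root, OF i])
    then have "2 * of_nat CARD('n) * \<alpha> (f (Suc i)) (killing_dual \<h> (\<alpha> (f i))) =
        cnj (2 * of_nat CARD('n) * \<alpha> (Suc i) (killing_dual \<h> (\<alpha> i)))"
      using root_at_dual[OF label_root label_root, OF f(1)[OF i(2)] f(1)[OF i(1)]]
        root_at_dual[OF label_root label_root, OF i(2) i(1)] by simp
    also have "\<dots> = -1" by (simp only: label_inner[OF i]) simp
    finally show ?thesis
      using label_inner[OF f(1)[OF i(1)] f(1)[OF i(2)]] by (auto split: if_splits)
  qed
  ultimately have "(\<forall>i\<in>?I. f i = i) \<or> (\<forall>i\<in>?I. f i = Suc (2*m-2) - i)"
    using f(1) by (intro path_automorphism) auto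
  then show ?thesis
  proof
    assume id: "\<forall>i\<in>?I. f i = i"
    let ?H = "H_tilde \<h> m \<alpha> (m - 1)"
    have dual: "conj_mat (killing_dual \<h> (\<alpha> i)) = - killing_dual \<h> (\<alpha> i)" if "i \<in> ?I" for i
    proof -
      have "twist (\<alpha> i) = \<alpha> i" using f(2)[OF that] id that by metis
      then show ?thesis using killing_dual_twist[OF label_root[OF that]] by (metis minus_minus)
    qed
    have "conj_mat ?H = - ?H"
      using dual[OF middle_labels(1)] dual[OF middle_labels(2)]
      by (simp add: H_tilde_middle conj_mat_add conj_mat_mscale del: One_nat_def)
    moreover have "- ?H \<in> \<q>"
      using H_tilde_middle_q unfolding q_eq q_algebra_def by (rule msp.span_neg)
    ultimately have "?H = 0" using direct[OF H_tilde_middle_q] by simp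
    moreover have "\<alpha> m 0 = 0"
      using label_functional(2)[OF middle_labels(2), of 0 0] msp.subspace_0[OF torus_subspace] by simp
    ultimately show ?thesis using middle_at_H_tilde(1) by simp
  next
    assume flip: "\<forall>i\<in>?I. f i = Suc (2*m-2) - i"
    have "Suc (2*m-2) - m = m - 1" using m by simp
    then show ?thesis using f(2)[OF middle_labels(2)] flip middle_labels(2) by auto
  qed
qed

lemma bracket_scaled_E: "bracket (a *\<^sub>m E i j) (b *\<^sub>m E k l) =
    (a * b) *\<^sub>m ((if j = k then E i l else 0) - (if l = i then E k j else 0))"
  by (simp add: bracket_mscale_left bracket_mscale_right) (simp add: bracket_def E_mult_E)

text \<open>The two middle simple roots span a root system of type \<open>A\<^sub>2\<close> that is stable under \<open>\<sigma>\<close>. The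
  following relations in the corresponding copy of \<open>sl(3)\<close> are all that is used of \<open>\<q>\<close>: \<open>X\<close> and
  \<open>Y\<close> are root vectors for the simple root \<open>\<alpha> m\<close> and for \<open>\<alpha> (m - 1) + \<alpha> m\<close>.\<close>

lemma middle_relations:
  obtains X Y H s t c k where "X \<in> \<q>" "Y \<in> \<q>" "H \<in> \<q>" "X \<noteq> 0"
    "bracket X Y = 0" "bracket X (conj_mat X) = 0"
    "bracket X (conj_mat Y) = s *\<^sub>m conj_mat X" "bracket Y (conj_mat X) = t *\<^sub>m X"
    "bracket Y (conj_mat Y) = c *\<^sub>m (H - conj_mat H)" "c \<noteq> 0"
    "bracket (conj_mat H) X = 0" "bracket H X = k *\<^sub>m X" "k \<noteq> 0"
proof -
  let ?N = "2 * complex_of_nat CARD('n)"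
  define \<beta> H where "\<beta> = \<alpha> (m - 1)" and "H = H_tilde \<h> m \<alpha> (m - 1)"
  have H_eq: "H = killing_dual \<h> \<beta> + 2 *\<^sub>m killing_dual \<h> (\<alpha> m)"
    by (simp only: H_def \<beta>_def H_tilde_middle)
  have at_H: "2 * of_nat CARD('n) * \<alpha> m H = 3" "2 * of_nat CARD('n) * \<beta> H = 0"
    unfolding H_def \<beta>_def by (rule middle_at_H_tilde)+
  have N: "?N \<noteq> 0" by simp
  have root: "\<alpha> m \<in> roots \<h>" "\<beta> \<in> roots \<h>" unfolding \<beta>_def by (rule label_root, rule middle_labels)+
  have pos: "\<alpha> m \<in> pos" "\<beta> \<in> pos" unfolding \<beta>_def by (rule label_pos, rule middle_labels)+
  have twist: "twist (\<alpha> m) = \<beta>" "twist \<beta> = \<alpha> m" unfolding \<beta>_def by (rule twist_middle) (metis twist_middle twist_twist)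
  obtain a b where ab: "a \<noteq> b" "\<beta> = rt a b" using root(2) by (rule root_cases)
  obtain c d where cd: "c \<noteq> d" "\<alpha> m = rt c d" using root(1) by (rule root_cases)
  have "?N * root_inner \<h> \<beta> (\<alpha> m) = -1"
    using label_inner[OF middle_labels, folded \<beta>_def] m by (simp only: root_at_dual[OF root]) auto
  then have "rt a b (E c c - E d d) = -1" using N by (simp add: ab(2) cd(2) root_inner_rt)
  then have "b = c \<and> a \<noteq> d \<or> a = d \<and> b \<noteq> c"
    using ab(1) cd(1) by (auto simp: rt_coroot split: if_splits)
  \<comment> \<open>The labelling is determined only up to the flip of the diagram, so both orders of the two roots occur.\<close>
  then obtain i j k where dist: "i \<noteq> j" "j \<noteq> k" "i \<noteq> k"
    and cases: "\<beta> = rt i j \<and> \<alpha> m = rt j k \<or> \<beta> = rt j k \<and> \<alpha> m = rt i j"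
    using ab cd by metis
  define \<gamma> where "\<gamma> = root_add \<beta> (\<alpha> m)"
  have \<gamma>: "\<gamma> = rt i k" using cases by (auto simp: \<gamma>_def root_add_def rt_def)
  have \<gamma>_pos: "\<gamma> \<in> pos"
    using pos_add[OF pos(2,1)] rt_in_roots[OF dist(3)] by (simp add: \<gamma> flip: \<gamma>_def)
  have ne: "\<gamma> \<noteq> \<beta>" "\<alpha> m \<noteq> \<beta>"
    using cases dist rt_inject unfolding \<gamma> by metis+
  have conj_roots: "root_conj (\<alpha> m) = root_neg \<beta>" "root_conj \<gamma> = root_neg \<gamma>"
    unfolding root_conj_eq \<gamma>_def twist_add twist by (simp_all add: root_add_def add.commute)
  define X Y where "X = e (\<alpha> m)" and "Y = e \<gamma>"
  have X: "X \<in> root_space \<h> (\<alpha> m)" "X \<noteq> 0" and Y: "Y \<in> root_space \<h> \<gamma>" "Y \<noteq> 0"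
    using generators pos(1) \<gamma>_pos by (auto simp: X_def Y_def)
  have nonzero: "conj_mat Z \<noteq> 0" if "Z \<noteq> 0" for Z :: "complex ^ 'n ^ 'n"
    using that by (simp add: vec_eq_iff)
  have conj_X: "conj_mat X \<in> root_space \<h> (root_neg \<beta>)" "conj_mat X \<noteq> 0"
    using conj_root_space[OF X(1)] nonzero[OF X(2)] by (simp_all add: conj_roots)
  have conj_Y: "conj_mat Y \<in> root_space \<h> (rt k i)" "conj_mat Y \<noteq> 0"
    using conj_root_space[OF Y(1)] nonzero[OF Y(2)] by (simp_all only: conj_roots) (simp_all add: \<gamma> root_neg_rt)
  have "e \<delta> \<in> \<q>" if "\<delta> \<in> pos" "\<delta> \<noteq> \<beta>" for \<delta>
    unfolding q_eq q_algebra_def \<beta>_def[symmetric] using that by (auto intro!: msp.span_base)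
  then have q: "X \<in> \<q>" "Y \<in> \<q>" unfolding X_def Y_def using pos(1) \<gamma>_pos ne by auto
  have dual_conj: "conj_mat (killing_dual \<h> (\<alpha> m)) = - killing_dual \<h> \<beta>"
    "conj_mat (killing_dual \<h> \<beta>) = - killing_dual \<h> (\<alpha> m)"
    using killing_dual_twist[OF root(1)] killing_dual_twist[OF root(2)] unfolding twist by (metis minus_minus)+
  have "H - conj_mat H = 3 *\<^sub>m (killing_dual \<h> \<beta> + killing_dual \<h> (\<alpha> m))"
    by (simp add: H_eq conj_mat_add conj_mat_mscale dual_conj vec_eq_iff)
  also have "\<dots> = (3 / ?N) *\<^sub>m (E i i - E k k)"
    using cases by (auto simp: killing_dual_rt vec_eq_iff algebra_simps diff_divide_distrib)
  finally have H_diff: "H - conj_mat H = (3 / ?N) *\<^sub>m (E i i - E k k)" .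
  obtain y where y: "Y = y *\<^sub>m E i k" "y \<noteq> 0"
    using root_space_rt[OF dist(3) Y(1)[unfolded \<gamma>]] Y(2) by (metis msp.scale_zero_left)
  obtain y' where y': "conj_mat Y = y' *\<^sub>m E k i" "y' \<noteq> 0"
    using root_space_rt[OF dist(3)[symmetric] conj_Y(1)] conj_Y(2) by (metis msp.scale_zero_left)
  have "bracket Y (conj_mat Y) = (y * y') *\<^sub>m (E i i - E k k)"
    unfolding y'(1) unfolding y(1)
    by (simp add: bracket_scaled_E mult.commute)
  also have "\<dots> = (y * y' * ?N / 3) *\<^sub>m (H - conj_mat H)"
    using N by (simp add: H_diff)
  finally have YY: "bracket Y (conj_mat Y) = (y * y' * ?N / 3) *\<^sub>m (H - conj_mat H)" .
  have "bracket X Y = 0 \<and> bracket X (conj_mat X) = 0 \<and>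
    (\<exists>s. bracket X (conj_mat Y) = s *\<^sub>m conj_mat X) \<and> (\<exists>t. bracket Y (conj_mat X) = t *\<^sub>m X)"
    using cases
  proof
    assume *: "\<beta> = rt i j \<and> \<alpha> m = rt j k"
    obtain x where x: "X = x *\<^sub>m E j k" "x \<noteq> 0"
      using root_space_rt[OF dist(2), of X] X * by (metis msp.scale_zero_left)
    have "conj_mat X \<in> root_space \<h> (rt j i)" using conj_X(1) * by (simp add: root_neg_rt)
    then obtain x' where x': "conj_mat X = x' *\<^sub>m E j i" "x' \<noteq> 0"
      using root_space_rt[OF dist(1)[symmetric], of "conj_mat X"] conj_X(2) by (metis msp.scale_zero_left)
    have "bracket X (conj_mat Y) = (x * y' / x') *\<^sub>m conj_mat X"
      unfolding x'(1) y'(1) unfolding x(1) using dist x'(2)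
      by (simp add: bracket_scaled_E mult.commute)
    moreover have "bracket Y (conj_mat X) = (- y * x' / x) *\<^sub>m X"
      unfolding x'(1) unfolding y(1) x(1) using dist x(2)
      by (simp add: bracket_scaled_E mult.commute)
    moreover have "bracket X Y = 0" "bracket X (conj_mat X) = 0"
      unfolding x'(1) unfolding y(1) x(1) using dist
      by (simp_all add: bracket_scaled_E)
    ultimately show ?thesis by blast
  next
    assume *: "\<beta> = rt j k \<and> \<alpha> m = rt i j"
    obtain x where x: "X = x *\<^sub>m E i j" "x \<noteq> 0"
      using root_space_rt[OF dist(1), of X] X * by (metis msp.scale_zero_left)
    have "conj_mat X \<in> root_space \<h> (rt k j)" using conj_X(1) * by (simp add: root_neg_rt)
    then obtain x' where x': "conj_mat X = x' *\<^sub>m E k j" "x' \<noteq> 0"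
      using root_space_rt[OF dist(2)[symmetric], of "conj_mat X"] conj_X(2) by (metis msp.scale_zero_left)
    have "bracket X (conj_mat Y) = (- x * y' / x') *\<^sub>m conj_mat X"
      unfolding x'(1) y'(1) unfolding x(1) using dist x'(2)
      by (simp add: bracket_scaled_E mult.commute)
    moreover have "bracket Y (conj_mat X) = (y * x' / x) *\<^sub>m X"
      unfolding x'(1) unfolding y(1) x(1) using dist x(2)
      by (simp add: bracket_scaled_E mult.commute)
    moreover have "bracket X Y = 0" "bracket X (conj_mat X) = 0"
      unfolding x'(1) unfolding y(1) x(1) using dist
      by (simp_all add: bracket_scaled_E)
    ultimately show ?thesis by blast
  qed
  then obtain s t where rel: "bracket X Y = 0" "bracket X (conj_mat X) = 0"
    "bracket X (conj_mat Y) = s *\<^sub>m conj_mat X" "bracket Y (conj_mat X) = t *\<^sub>m X" by blast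
  have H_torus: "H \<in> \<h>" unfolding H_def using m by (intro H_tilde_torus) auto
  have "\<alpha> m (conj_mat H) = cnj (root_conj (\<alpha> m) H)" by (simp add: root_conj_def)
  also have "\<dots> = 0" using at_H(2) by (simp add: conj_roots(1) root_neg_def)
  finally have "bracket (conj_mat H) X = 0"
    using X(1) conj_torus[OF H_torus] by (simp add: root_space_def)
  moreover have "bracket H X = \<alpha> m H *\<^sub>m X" using X(1) H_torus by (simp add: root_space_def)
  moreover have "\<alpha> m H \<noteq> 0" using at_H(1) by auto
  moreover have "y * y' * ?N / 3 \<noteq> 0" using y(2) y'(2) N by simp
  ultimately show thesis
    by (intro that[OF q H_tilde_middle_q[folded H_def] X(2) rel YY])
qed

end


section \<open>Types with respect to the complex structure\<close>

lemma of_real_mat_Re_Im: "Z = of_real_mat (Re_mat Z) + \<i> *\<^sub>m of_real_mat (Im_mat Z)"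
  by (simp add: vec_eq_iff of_real_mat_def Re_mat_def Im_mat_def complex_eq_iff)

lemma Re_mat_simps [simp]: "Re_mat (A + B) = Re_mat A + Re_mat B" "Re_mat (conj_mat A) = Re_mat A"
    "Re_mat (c *\<^sub>m A) = Re c *\<^sub>m Re_mat A + (- Im c) *\<^sub>m Im_mat A" "Re_mat 0 = 0"
  and Im_mat_simps [simp]: "Im_mat (A + B) = Im_mat A + Im_mat B" "Im_mat (conj_mat A) = (-1) *\<^sub>m Im_mat A"
    "Im_mat (c *\<^sub>m A) = Re c *\<^sub>m Im_mat A + Im c *\<^sub>m Re_mat A" "Im_mat 0 = 0"
  by (simp_all add: vec_eq_iff Re_mat_def Im_mat_def)

lemma Re_Im_mat_sl [simp]: "Z \<in> sl \<Longrightarrow> Re_mat Z \<in> sl" "Z \<in> sl \<Longrightarrow> Im_mat Z \<in> sl"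
  by (simp_all add: sl_def trace_def Re_mat_def Im_mat_def flip: Re_sum Im_sum)

lemma sl_closed [simp]: "A \<in> sl \<Longrightarrow> B \<in> sl \<Longrightarrow> A + B \<in> sl" "A \<in> sl \<Longrightarrow> c *\<^sub>m A \<in> sl" "0 \<in> sl" "A \<in> sl \<Longrightarrow> - A \<in> sl"
    "A \<in> sl \<Longrightarrow> B \<in> sl \<Longrightarrow> A - B \<in> sl"
  using msp.subspace_add[OF subspace_sl] msp.subspace_scale[OF subspace_sl] msp.subspace_0[OF subspace_sl]
    msp.subspace_neg[OF subspace_sl] msp.subspace_diff[OF subspace_sl] by blast+

lemma of_real_mat_simps: "of_real_mat (A + B) = of_real_mat A + of_real_mat B"
    "of_real_mat (r *\<^sub>m A) = of_real r *\<^sub>m of_real_mat A" "of_real_mat (- A) = - of_real_mat A"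
    "of_real_mat (A - B) = of_real_mat A - of_real_mat B"
    "of_real_mat 0 = 0" "conj_mat (of_real_mat A) = of_real_mat A"
  by (simp_all add: vec_eq_iff of_real_mat_def)

lemma Re_Im_of_real_mat [simp]: "Re_mat (of_real_mat A) = A" "Im_mat (of_real_mat A) = 0"
  by (simp_all add: vec_eq_iff of_real_mat_def Re_mat_def Im_mat_def)

lemma of_real_mat_sl [simp]: "A \<in> sl \<Longrightarrow> of_real_mat A \<in> sl"
  by (simp add: sl_def trace_def of_real_mat_def flip: of_real_sum)

text \<open>The endomorphism \<open>J\<close> whose eigenspaces for \<open>i\<close> and \<open>-i\<close> are \<open>\<q>\<close> and its conjugate.\<close>

locale complex_structure =
  fixes \<q> :: "(complex ^ 'n ^ 'n) set" and J :: "real ^ 'n ^ 'n \<Rightarrow> real ^ 'n ^ 'n"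
  assumes cpx: "complex_structure_of \<q> J"
begin

lemma J_linear: "A \<in> sl \<Longrightarrow> B \<in> sl \<Longrightarrow> J (A + B) = J A + J B" "A \<in> sl \<Longrightarrow> J (r *\<^sub>m A) = r *\<^sub>m J A"
  using cpx by (auto simp: complex_structure_of_def mlinear_on_def)

lemma J_sl [simp]: "A \<in> sl \<Longrightarrow> J A \<in> sl"
  using cpx by (auto simp: complex_structure_of_def)

lemma J_zero [simp]: "J 0 = 0"
  using J_linear(2)[of 0 0] by simp

lemma J_minus: "A \<in> sl \<Longrightarrow> J (- A) = - J A" "A \<in> sl \<Longrightarrow> B \<in> sl \<Longrightarrow> J (A - B) = J A - J B"
proof -
  show *: "A \<in> sl \<Longrightarrow> J (- A) = - J A" for A using J_linear(2)[of A "-1"] by simp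
  show "A \<in> sl \<Longrightarrow> B \<in> sl \<Longrightarrow> J (A - B) = J A - J B"
    using J_linear(1)[of A "- B"] *[of B] by simp
qed

lemma J_J: "A \<in> sl \<Longrightarrow> J (J A) = - A"
  using cpx by (auto simp: complex_structure_of_def)

lemma q_iff: "Z \<in> \<q> \<longleftrightarrow> Z \<in> sl \<and> cext J Z = \<i> *\<^sub>m Z"
  using cpx by (auto simp: complex_structure_of_def)

lemma cext_sl: "Z \<in> sl \<Longrightarrow> cext J Z \<in> sl"
  by (simp add: cext_def)

lemma cext_add: "Z \<in> sl \<Longrightarrow> W \<in> sl \<Longrightarrow> cext J (Z + W) = cext J Z + cext J W"
  by (simp add: cext_def J_linear of_real_mat_simps msp.scale_right_distrib)

lemma cext_scale: "Z \<in> sl \<Longrightarrow> cext J (c *\<^sub>m Z) = c *\<^sub>m cext J Z"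
  by (simp add: cext_def J_linear J_minus of_real_mat_simps) (simp add: vec_eq_iff complex_eq_iff algebra_simps)

lemma cext_diff: "Z \<in> sl \<Longrightarrow> W \<in> sl \<Longrightarrow> cext J (Z - W) = cext J Z - cext J W"
  using cext_add[of Z "(-1) *\<^sub>m W"] cext_scale[of W "-1"] by simp

lemma cext_conj: "Z \<in> sl \<Longrightarrow> cext J (conj_mat Z) = conj_mat (cext J Z)"
  by (simp add: cext_def J_minus of_real_mat_simps conj_mat_add conj_mat_mscale)

lemma cext_cext: "Z \<in> sl \<Longrightarrow> cext J (cext J Z) = - Z"
  by (simp add: cext_def J_J of_real_mat_simps) (simp add: vec_eq_iff of_real_mat_def Re_mat_def Im_mat_def complex_eq_iff)

lemma part_sum: "Z = part10 J Z + part01 J Z"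
  by (simp add: part10_def part01_def vec_eq_iff field_simps)

lemma part10_q:
  assumes "Z \<in> sl" shows "part10 J Z \<in> \<q>"
proof -
  have "cext J (part10 J Z) = (1/2) *\<^sub>m (cext J Z + \<i> *\<^sub>m Z)"
    using assms by (simp add: part10_def cext_scale cext_diff cext_sl cext_cext)
  also have "\<dots> = \<i> *\<^sub>m part10 J Z" by (simp add: part10_def vec_eq_iff algebra_simps)
  finally show ?thesis using assms by (simp add: q_iff part10_def cext_sl)
qed

lemma part01_conj:
  assumes "Z \<in> sl" shows "part01 J Z = conj_mat (part10 J (conj_mat Z))"
  using assms by (simp add: part01_def part10_def cext_conj conj_mat_mscale conj_mat_diff)

lemma q_decomposition:
  assumes "Z \<in> sl" shows "\<exists>A B. A \<in> \<q> \<and> B \<in> \<q> \<and> Z = A + conj_mat B"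
  using part_sum[of Z] part10_q[OF assms] part10_q[of "conj_mat Z"] part01_conj[OF assms] assms by auto

lemma q_sl: "Z \<in> \<q> \<Longrightarrow> Z \<in> sl"
  by (simp add: q_iff)

lemma parts_q [simp]:
  assumes "Z \<in> \<q>"
  shows "part10 J Z = Z" "part01 J Z = 0" "part10 J (conj_mat Z) = 0" "part01 J (conj_mat Z) = conj_mat Z"
proof -
  have Z: "Z \<in> sl" "cext J Z = \<i> *\<^sub>m Z" using assms by (simp_all add: q_iff)
  then show "part10 J Z = Z" "part01 J Z = 0" "part10 J (conj_mat Z) = 0" "part01 J (conj_mat Z) = conj_mat Z"
    by (simp_all add: part10_def part01_def cext_conj) (simp_all add: vec_eq_iff)
qed

lemma q_direct:
  assumes "Z \<in> \<q>" "conj_mat Z \<in> \<q>" shows "Z = 0"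
  using parts_q(2)[OF assms(2)] parts_q(4)[OF assms(1)] by (metis conj_mat_conj_mat conj_mat_zero)

lemma part_sl [simp]: "Z \<in> sl \<Longrightarrow> part10 J Z \<in> sl" "Z \<in> sl \<Longrightarrow> part01 J Z \<in> sl"
  by (simp_all add: part10_def part01_def cext_sl)

lemma part_zero [simp]: "part10 J 0 = 0" "part01 J 0 = 0"
  by (simp_all add: part10_def part01_def cext_def of_real_mat_simps)

lemma part_scale:
  assumes "Z \<in> sl" shows "part10 J (c *\<^sub>m Z) = c *\<^sub>m part10 J Z" "part01 J (c *\<^sub>m Z) = c *\<^sub>m part01 J Z"
  using assms by (simp_all add: part10_def part01_def cext_scale) (simp_all add: vec_eq_iff algebra_simps)

lemma part01_diff: "Z \<in> sl \<Longrightarrow> W \<in> sl \<Longrightarrow> part01 J (Z - W) = part01 J Z - part01 J W"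
  by (simp add: part01_def cext_diff) (simp add: vec_eq_iff field_simps)

lemma q_scale: "Z \<in> \<q> \<Longrightarrow> c *\<^sub>m Z \<in> \<q>"
  by (simp add: q_iff cext_scale mult.commute)

lemma conj_q_scale: "c *\<^sub>m conj_mat Z = conj_mat (cnj c *\<^sub>m Z)"
  by (simp add: conj_mat_mscale)


section \<open>The operators on forms evaluated at vectors of pure type\<close>

text \<open>In the evaluation of the components of a form, the summands that do not match the types of the
  arguments have a zero argument. The vanishing of forms on lists with a zero entry, here required
  only for lists of elements of \<open>sl\<close>, therefore suffices to discard them.\<close>

lemma bidegree_part_zero:
  assumes "\<And>ys. length ys = p + q \<Longrightarrow> 0 \<in> set ys \<Longrightarrow> set ys \<subseteq> sl \<Longrightarrow> \<eta> ys = 0" "0 \<in> set xs" "set xs \<subseteq> sl"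
  shows "bidegree_part J p q \<eta> xs = 0"
proof (cases "length xs = p + q")
  case True
  obtain i where i: "i < p + q" "xs ! i = 0" using assms(2) True by (auto simp: in_set_conv_nth)
  have "\<eta> (map (\<lambda>i. if i \<in> S then part10 J (xs ! i) else part01 J (xs ! i)) [0..<p + q]) = 0" for S
  proof (rule assms(1))
    let ?ys = "map (\<lambda>i. if i \<in> S then part10 J (xs ! i) else part01 J (xs ! i)) [0..<p + q]"
    show "0 \<in> set ?ys" using i by (auto simp: image_iff intro!: bexI[of _ i])
    have "xs ! l \<in> sl" if "l < p + q" for l using assms(3) True that by (metis nth_mem subsetD)
    then show "set ?ys \<subseteq> sl" by auto
  qed simp
  then show ?thesis by (simp add: bidegree_part_def)
qed (simp add: bidegree_part_def)

lemma ce_d_zero: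
  assumes "\<And>ys. 0 \<in> set ys \<Longrightarrow> set ys \<subseteq> sl \<Longrightarrow> \<eta> ys = 0" "0 \<in> set xs" "set xs \<subseteq> sl"
  shows "ce_d \<eta> xs = 0"
  unfolding ce_d_def
proof (intro sum.neutral ballI, clarify)
  fix i j assume ij: "i < j" "j < length xs"
  obtain l where l: "l < length xs" "xs ! l = 0" using assms(2) by (auto simp: in_set_conv_nth)
  have "0 \<in> set (bracket (xs ! i) (xs ! j) # nths xs (- {i, j}))"
  proof (cases "l = i \<or> l = j")
    case True
    then show ?thesis using l(2) by auto
  next
    case False
    then show ?thesis using l by (auto simp: set_nths)
  qed
  moreover have "set (bracket (xs ! i) (xs ! j) # nths xs (- {i, j})) \<subseteq> sl"
    using assms(3) by (auto simp: bracket_in_sl dest: in_set_nthsD)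
  ultimately show "(- 1) ^ (i + j) * \<eta> (bracket (xs ! i) (xs ! j) # nths xs (- {i, j})) = 0"
    by (simp add: assms(1))
qed

text \<open>The component of bidegree \<open>(p,q)\<close> at a list of vectors of pure type, with those of type \<open>(1,0)\<close>
  at the positions in \<open>T\<close>.\<close>

lemma bidegree_part_pure:
  assumes zero: "\<And>ys. length ys = p + q \<Longrightarrow> 0 \<in> set ys \<Longrightarrow> set ys \<subseteq> sl \<Longrightarrow> \<eta> ys = 0"
    and len: "length xs = p + q" and T: "T \<subseteq> {..<p + q}"
    and type10: "\<And>i. i \<in> T \<Longrightarrow> xs ! i \<in> \<q>"
    and type01: "\<And>i. i < p + q \<Longrightarrow> i \<notin> T \<Longrightarrow> conj_mat (xs ! i) \<in> \<q>"
  shows "bidegree_part J p q \<eta> xs = (if card T = p then \<eta> xs else 0)"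
proof -
  let ?A = "{S. S \<subseteq> {..<p + q} \<and> card S = p}"
  let ?ys = "\<lambda>S. map (\<lambda>i. if i \<in> S then part10 J (xs ! i) else part01 J (xs ! i)) [0..<p + q]"
  have parts: "part10 J (xs ! i) = (if i \<in> T then xs ! i else 0)"
    "part01 J (xs ! i) = (if i \<in> T then 0 else xs ! i)" if "i < p + q" for i
    using type10[of i] type01[of i] that parts_q(3,4)[of "conj_mat (xs ! i)"] by auto
  have eta: "\<eta> (?ys S) = (if S = T then \<eta> xs else 0)" if S: "S \<in> ?A" for S
  proof (cases "S = T")
    case True
    have "?ys T = xs" using len by (intro nth_equalityI) (auto simp: parts)
    then show ?thesis using True by simp
  next
    case False
    then obtain i where "i < p + q" "i \<in> S \<longleftrightarrow> i \<notin> T" using S T by blast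
    then have "0 \<in> set (?ys S)" by (auto simp: parts image_iff intro!: bexI[of _ i])
    moreover have "xs ! l \<in> sl" if "l < p + q" for l
      using type10[of l] type01[of l] that q_sl conj_mat_sl by blast
    then have "set (?ys S) \<subseteq> sl" by auto
    ultimately show ?thesis using False zero[of "?ys S"] by simp
  qed
  have "bidegree_part J p q \<eta> xs = (\<Sum>S\<in>?A. \<eta> (?ys S))" by (simp add: bidegree_part_def len)
  also have "\<dots> = (\<Sum>S\<in>?A. if S = T then \<eta> xs else 0)" by (intro sum.cong refl eta)
  also have "\<dots> = (if T \<in> ?A then \<eta> xs else 0)"
    by (rule sum.delta) (rule finite_subset[of _ "Pow {..<p + q}"], auto)
  finally show ?thesis using T by simp
qed

lemma bidegree_part_11:
  "bidegree_part J 1 1 \<eta> [A, B] = \<eta> [part10 J A, part01 J B] + \<eta> [part01 J A, part10 J B]"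
proof -
  have "{S. S \<subseteq> {..<2} \<and> card S = 1} = {{0}, {1::nat}}"
    by (auto simp: card_1_singleton_iff less_2_cases_iff)
  then show ?thesis by (simp add: bidegree_part_def numeral_2_eq_2 upt_rec)
qed

lemma bidegree_part_12:
  "bidegree_part J 1 2 \<eta> [A, B, C] = \<eta> [part10 J A, part01 J B, part01 J C] +
    \<eta> [part01 J A, part10 J B, part01 J C] + \<eta> [part01 J A, part01 J B, part10 J C]"
proof -
  have "{S. S \<subseteq> {..<3} \<and> card S = 1} = {{0}, {1}, {2::nat}}"
    by (auto simp: card_1_singleton_iff numeral_3_eq_3 less_Suc_eq numeral_2_eq_2)
  then show ?thesis by (simp add: bidegree_part_def numeral_3_eq_3 numeral_2_eq_2 upt_rec)
qed

lemma ce_d_3: "ce_d \<eta> [A, B, C] =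
    - \<eta> [bracket A B, C] + \<eta> [bracket A C, B] - \<eta> [bracket B C, A]"
proof -
  have "{(i, j). i < j \<and> j < length [A, B, C]} = {(0, 1), (0, 2), (1, 2)}" by auto
  then show ?thesis unfolding ce_d_def by (simp add: nths_Cons)
qed

lemma ce_d_4: "ce_d \<eta> [A, B, C, D] =
    - \<eta> [bracket A B, C, D] + \<eta> [bracket A C, B, D] - \<eta> [bracket A D, B, C]
    - \<eta> [bracket B C, A, D] + \<eta> [bracket B D, A, C] - \<eta> [bracket C D, A, B]"
proof -
  have "{(i, j). i < j \<and> j < length [A, B, C, D]} = {(0, 1), (0, 2), (0, 3), (1, 2), (1, 3), (2, 3)}" by auto
  then show ?thesis unfolding ce_d_def by (simp add: nths_Cons)
qed

lemma delbar_zero: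
  assumes "\<And>ys. length ys = 2 \<Longrightarrow> 0 \<in> set ys \<Longrightarrow> set ys \<subseteq> sl \<Longrightarrow> \<eta> ys = 0" "length xs = 3" "0 \<in> set xs" "set xs \<subseteq> sl"
  shows "delbar_op J \<eta> xs = 0"
proof -
  have "bidegree_part J p (2 - p + 1) (ce_d (bidegree_part J p (2 - p) \<eta>)) xs = 0" if "p \<le> 2" for p
    using that assms by (intro bidegree_part_zero ce_d_zero) auto
  then show ?thesis using assms(2) by (simp add: delbar_op_def Let_def)
qed

lemma delbar_pure:
  assumes zero: "\<And>ys. length ys = 2 \<Longrightarrow> 0 \<in> set ys \<Longrightarrow> set ys \<subseteq> sl \<Longrightarrow> \<eta> ys = 0"
    and "U \<in> \<q>" "V \<in> \<q>" "W \<in> \<q>"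
  shows "delbar_op J \<eta> [conj_mat U, V, conj_mat W] =
    ce_d (bidegree_part J 1 1 \<eta>) [conj_mat U, V, conj_mat W]"
proof -
  let ?xs = "[conj_mat U, V, conj_mat W]"
  have summand: "bidegree_part J p (2 - p + 1) (ce_d (bidegree_part J p (2 - p) \<eta>)) ?xs =
      (if p = 1 then ce_d (bidegree_part J 1 1 \<eta>) ?xs else 0)" if "p \<le> 2" for p
  proof -
    have "bidegree_part J p (2 - p + 1) (ce_d (bidegree_part J p (2 - p) \<eta>)) ?xs =
        (if card {1::nat} = p then ce_d (bidegree_part J p (2 - p) \<eta>) ?xs else 0)"
      by (rule bidegree_part_pure)
        (use that assms in \<open>auto simp: less_Suc_eq numeral_3_eq_3 nth_Cons' q_sl bracket_in_sl intro!: ce_d_zero bidegree_part_zero\<close>)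
    then show ?thesis by auto
  qed
  have "delbar_op J \<eta> ?xs =
      (\<Sum>p\<le>2. bidegree_part J p (2 - p + 1) (ce_d (bidegree_part J p (2 - p) \<eta>)) ?xs)"
    by (simp add: delbar_op_def Let_def numeral_2_eq_2)
  also have "\<dots> = (\<Sum>p\<le>(2::nat). if p = 1 then ce_d (bidegree_part J 1 1 \<eta>) ?xs else 0)"
    by (intro sum.cong refl summand) simp
  finally show ?thesis by simp
qed

lemma del_pure:
  assumes zero: "\<And>ys. length ys = 3 \<Longrightarrow> 0 \<in> set ys \<Longrightarrow> set ys \<subseteq> sl \<Longrightarrow> \<eta> ys = 0"
    and "U \<in> \<q>" "V \<in> \<q>" "W \<in> \<q>" "Z \<in> \<q>"
  shows "del_op J \<eta> [U, V, conj_mat W, conj_mat Z] =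
    ce_d (bidegree_part J 1 2 \<eta>) [U, V, conj_mat W, conj_mat Z]"
proof -
  let ?xs = "[U, V, conj_mat W, conj_mat Z]"
  have summand: "bidegree_part J (p + 1) (3 - p) (ce_d (bidegree_part J p (3 - p) \<eta>)) ?xs =
      (if p = 1 then ce_d (bidegree_part J 1 2 \<eta>) ?xs else 0)" if "p \<le> 3" for p
  proof -
    have "bidegree_part J (p + 1) (3 - p) (ce_d (bidegree_part J p (3 - p) \<eta>)) ?xs =
        (if card {0, 1::nat} = p + 1 then ce_d (bidegree_part J p (3 - p) \<eta>) ?xs else 0)"
      by (rule bidegree_part_pure)
        (use that assms in \<open>auto simp: less_Suc_eq numeral_3_eq_3 nth_Cons' q_sl bracket_in_sl intro!: ce_d_zero bidegree_part_zero\<close>)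
    then show ?thesis by auto
  qed
  have "del_op J \<eta> ?xs =
      (\<Sum>p\<le>3. bidegree_part J (p + 1) (3 - p) (ce_d (bidegree_part J p (3 - p) \<eta>)) ?xs)"
    by (simp add: del_op_def Let_def numeral_3_eq_3)
  also have "\<dots> = (\<Sum>p\<le>(3::nat). if p = 1 then ce_d (bidegree_part J 1 2 \<eta>) ?xs else 0)"
    by (intro sum.cong refl summand) simp
  finally show ?thesis by simp
qed

end


section \<open>The obstruction to the pluriclosed condition\<close>

text \<open>A complex structure with a compatible metric.\<close>

locale hermitian_structure = complex_structure \<q> J for \<q> :: "(complex ^ 'n ^ 'n) set" and J +
  fixes g :: "real ^ 'n ^ 'n \<Rightarrow> real ^ 'n ^ 'n \<Rightarrow> real"
  assumes metric: "compatible_metric J g"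
begin

lemma g_right: "A \<in> sl \<Longrightarrow> B \<in> sl \<Longrightarrow> C \<in> sl \<Longrightarrow> g A (B + C) = g A B + g A C"
    "A \<in> sl \<Longrightarrow> B \<in> sl \<Longrightarrow> g A (r *\<^sub>m B) = r * g A B"
  using metric by (auto simp: compatible_metric_def mfunctional_on_def)

lemma g_sym: "A \<in> sl \<Longrightarrow> B \<in> sl \<Longrightarrow> g A B = g B A"
  and g_pos: "A \<in> sl \<Longrightarrow> A \<noteq> 0 \<Longrightarrow> g A A > 0"
  using metric by (auto simp: compatible_metric_def)

lemma g_left: "A \<in> sl \<Longrightarrow> B \<in> sl \<Longrightarrow> C \<in> sl \<Longrightarrow> g (B + C) A = g B A + g C A"
    "A \<in> sl \<Longrightarrow> B \<in> sl \<Longrightarrow> g (r *\<^sub>m B) A = r * g B A"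
  using g_right[of A B] g_sym[of A] by auto

lemma g_minus: "A \<in> sl \<Longrightarrow> B \<in> sl \<Longrightarrow> g (- A) B = - g A B" "A \<in> sl \<Longrightarrow> B \<in> sl \<Longrightarrow> g A (- B) = - g A B"
  using g_left(2)[of B A "-1"] g_right(2)[of A B "-1"] by simp_all

text \<open>The fundamental form as a function of two arguments.\<close>

definition form :: "complex ^ 'n ^ 'n \<Rightarrow> complex ^ 'n ^ 'n \<Rightarrow> complex"
  where "form A B = cext2 (\<lambda>X Y. g (J X) Y) A B"

lemma form_scale:
  assumes "A \<in> sl" "B \<in> sl"
  shows "form (c *\<^sub>m A) B = c * form A B" "form A (c *\<^sub>m B) = c * form A B"
proof -
  have minus: "- M = (-1) *\<^sub>m M" for M :: "real ^ 'n ^ 'n" by simp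
  have diff: "M - N = M + (-1) *\<^sub>m N" for M N :: "real ^ 'n ^ 'n" by simp
  show "form (c *\<^sub>m A) B = c * form A B" "form A (c *\<^sub>m B) = c * form A B"
    using assms unfolding form_def cext2_def Re_mat_simps Im_mat_simps
    by (simp_all only: J_linear g_left g_right sl_closed Re_Im_mat_sl J_sl)
      (simp_all add: complex_eq_iff algebra_simps)
qed

lemma form_zero [simp]: "A \<in> sl \<Longrightarrow> form 0 A = 0" "A \<in> sl \<Longrightarrow> form A 0 = 0"
  using form_scale[of A 0 0] form_scale[of 0 A 0] by simp_all

text \<open>If \<open>X = A + i B\<close> lies in \<open>\<q>\<close>, then \<open>J A = - B\<close> and \<open>J B = A\<close>, and the value is
  \<open>- i (g(A,A) + g(B,B))\<close>.\<close>

lemma form_conj_self: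
  assumes "X \<in> \<q>" "X \<noteq> 0" shows "form (conj_mat X) X \<noteq> 0"
proof -
  let ?A = "Re_mat X" and ?B = "Im_mat X"
  have X: "X \<in> sl" "cext J X = \<i> *\<^sub>m X" using assms(1) by (simp_all add: q_iff)
  then have sl: "?A \<in> sl" "?B \<in> sl" by simp_all
  have "Re_mat (cext J X) = J ?A" "Im_mat (cext J X) = J ?B" by (simp_all add: cext_def)
  then have J: "J ?A = - ?B" "J ?B = ?A" by (simp_all add: X(2))
  have "form (conj_mat X) X = - \<i> * of_real (g ?A ?A + g ?B ?B)"
    using sl by (simp add: form_def cext2_def J J_minus g_minus g_sym[OF sl] algebra_simps)
  moreover have "g ?A ?A + g ?B ?B > 0"
  proof -
    have nonneg: "g C C \<ge> 0" if "C \<in> sl" for C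
      using g_pos[OF that] g_right(2)[of 0 0 0] by (cases "C = 0") auto
    have "?A \<noteq> 0 \<or> ?B \<noteq> 0" using assms(2) of_real_mat_Re_Im[of X] by (auto simp: of_real_mat_simps)
    then show ?thesis using nonneg[OF sl(1)] nonneg[OF sl(2)] g_pos[OF sl(1)] g_pos[OF sl(2)] by force
  qed
  ultimately have "form (conj_mat X) X = - \<i> * of_real (g ?A ?A + g ?B ?B)" "g ?A ?A + g ?B ?B \<noteq> 0" by auto
  then show ?thesis by (simp del: of_real_add)
qed

lemma fundamental_form_eq: "fundamental_form J g [A, B] = form A B"
  by (simp add: fundamental_form_def form_def)

lemma fundamental_form_zero:
  assumes "length ys = 2" "0 \<in> set ys" "set ys \<subseteq> sl"
  shows "fundamental_form J g ys = 0"
proof -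
  obtain A B where "ys = [A, B]" using assms(1) by (auto simp: length_Suc_conv numeral_2_eq_2)
  then show ?thesis using assms by (auto simp: fundamental_form_eq)
qed

lemma delbar_form:
  assumes "U \<in> \<q>" "V \<in> \<q>" "W \<in> \<q>"
  shows "delbar_op J (fundamental_form J g) [conj_mat U, V, conj_mat W] =
    - form (part10 J (bracket (conj_mat U) V)) (conj_mat W)
    + form (part01 J (bracket (conj_mat U) (conj_mat W))) V
    - form (part10 J (bracket V (conj_mat W))) (conj_mat U)"
  using assms by (subst delbar_pure[OF fundamental_form_zero])
    (auto simp: ce_d_3 bidegree_part_11 fundamental_form_eq bracket_in_sl q_sl simp del: One_nat_def)

text \<open>With the stated brackets, \<open>\<partial>\<close> of \<open>\<partial>\<close>-bar of the fundamental form, evaluated at \<open>X\<close>, \<open>Y\<close> and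
  their conjugates, is a nonzero multiple of the squared length of \<open>X\<close>: among the six brackets of
  these vectors only that of \<open>Y\<close> with its conjugate contributes.\<close>

lemma not_pluriclosed:
  assumes q: "X \<in> \<q>" "Y \<in> \<q>" "H \<in> \<q>" and X: "X \<noteq> 0"
    and XY: "bracket X Y = 0" and XX': "bracket X (conj_mat X) = 0"
    and XY': "bracket X (conj_mat Y) = s *\<^sub>m conj_mat X"
    and YX': "bracket Y (conj_mat X) = t *\<^sub>m X"
    and YY': "bracket Y (conj_mat Y) = c *\<^sub>m (H - conj_mat H)" and c: "c \<noteq> 0"
    and HX': "bracket (conj_mat H) X = 0" and HX: "bracket H X = k *\<^sub>m X" and k: "k \<noteq> 0"
  shows "\<not> pluriclosed J g"
proof
  assume "pluriclosed J g"
  let ?\<eta> = "delbar_op J (fundamental_form J g)"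
  let ?xs = "[X, Y, conj_mat X, conj_mat Y]"
  have sl: "X \<in> sl" "Y \<in> sl" "H \<in> sl" using q q_sl by auto
  have zero: "?\<eta> ys = 0" if "length ys = 3" "0 \<in> set ys" "set ys \<subseteq> sl" for ys
    using that by (intro delbar_zero fundamental_form_zero)
  have "0 = del_op J ?\<eta> ?xs"
    using \<open>pluriclosed J g\<close> sl by (simp add: pluriclosed_def)
  also have "\<dots> = ce_d (bidegree_part J 1 2 ?\<eta>) ?xs"
    using q by (intro del_pure zero)
  also have "\<dots> = - ?\<eta> [s *\<^sub>m conj_mat X, Y, conj_mat X] + ?\<eta> [- c *\<^sub>m conj_mat H, X, conj_mat X]"
  proof -
    have part: "part01 J (c *\<^sub>m (H - conj_mat H)) = - c *\<^sub>m conj_mat H"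
      "part01 J (s *\<^sub>m conj_mat X) = s *\<^sub>m conj_mat X" "part01 J (t *\<^sub>m X) = 0"
      using q sl by (simp_all add: part_scale part01_diff)
    have "bracket (conj_mat X) (conj_mat Y) = 0" using XY by (simp flip: conj_mat_bracket)
    then show ?thesis
      using q sl unfolding ce_d_4 bidegree_part_12
      by (simp add: XY XX' XY' YX' YY' part zero)
  qed
  \<comment> \<open>The two surviving terms, from the brackets of \<open>Y\<close> with the first and the last argument, cancel.\<close>
  also have "?\<eta> [s *\<^sub>m conj_mat X, Y, conj_mat X] = 0"
  proof -
    obtain u where u: "bracket (conj_mat X) Y = u *\<^sub>m X" "u = - t"
      using YX' bracket_swap[of "conj_mat X" Y] by simp
    show ?thesis
      unfolding conj_q_scale delbar_form[OF q_scale[OF q(1)] q(2) q(1)]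
      using q sl by (simp add: conj_mat_mscale bracket_mscale_left u(1) YX' part_scale form_scale)
        (simp add: u(2))
  qed
  also have "?\<eta> [- c *\<^sub>m conj_mat H, X, conj_mat X] = - c * cnj k * form (conj_mat X) X"
  proof -
    have HX'': "bracket (conj_mat H) (conj_mat X) = cnj k *\<^sub>m conj_mat X"
      by (simp add: HX conj_mat_mscale flip: conj_mat_bracket)
    have "?\<eta> [a *\<^sub>m conj_mat H, X, conj_mat X] = a * cnj k * form (conj_mat X) X" for a
      unfolding conj_q_scale delbar_form[OF q_scale[OF q(3)] q(1) q(1)]
      using q sl by (simp add: conj_mat_mscale bracket_mscale_left HX'' HX' XX' part_scale form_scale)
    then show ?thesis .
  qed
  finally show False using c k form_conj_self[OF q(1) X] by simp
qed

end


section \<open>Non-existence of compatible pluriclosed metrics\<close>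

theorem corollary5p5:
  fixes m :: nat
    and \<theta> J :: "real ^ 'n::finite ^ 'n \<Rightarrow> real ^ 'n ^ 'n"
    and \<h>\<^sub>0 :: "(real ^ 'n ^ 'n) set"
    and \<h> \<q> :: "(complex ^ 'n ^ 'n) set"
    and ts ps :: "(real ^ 'n ^ 'n) list"
    and Hs :: "(complex ^ 'n ^ 'n) list"
    and \<alpha> :: "nat \<Rightarrow> complex ^ 'n ^ 'n \<Rightarrow> complex"
    and e :: "(complex ^ 'n ^ 'n \<Rightarrow> complex) \<Rightarrow> complex ^ 'n ^ 'n"
  assumes "m \<ge> 2" and "CARD('n) = 2 * m - 1"
    and "cartan_involution \<theta>"
    and "maximally_compact \<theta> \<h>\<^sub>0"
    and "\<h> = complexify \<h>\<^sub>0"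
    and "ordered_basis ts (\<h>\<^sub>0 \<inter> k_part \<theta>)"
    and "ordered_basis ps (\<h>\<^sub>0 \<inter> p_part \<theta>)"
    and "Hs = lex_basis ts ps"
    and "standard_labelling \<h> Hs (2 * m - 2) \<alpha>"
    and "root_generators \<h> Hs m \<alpha> e"
    and "\<q> = q_algebra \<h> Hs m \<alpha> e"
    and "complex_structure_of \<q> J"
  shows "\<not> (\<exists>g. compatible_metric J g \<and> pluriclosed J g)"
proof
  assume "\<exists>g. compatible_metric J g \<and> pluriclosed J g"
  then obtain g where g: "compatible_metric J g" "pluriclosed J g" by blast
  interpret hermitian_structure \<q> J g
    using assms(12) g(1) by unfold_locales
  have \<h>\<^sub>0: "msp.subspace \<h>\<^sub>0" "cartan_subalgebra \<h>"
    using assms(4) unfolding assms(5) by (simp_all add: maximally_compact_def real_cartan_subalgebra_def)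
  obtain P Q :: "complex ^ 'n ^ 'n" where PQ: "P ** Q = mat 1" "Q ** P = mat 1"
    "\<h> = {Z \<in> sl. \<forall>i j. i \<noteq> j \<longrightarrow> (Q ** Z ** P) $ i $ j = 0}"
    by (rule cartan_subalgebra_diagonal[OF \<h>\<^sub>0(2)])
  interpret root_data P Q \<h> Hs m \<alpha> e \<q>
  proof
    show "conj_mat X \<in> \<h>" if "X \<in> \<h>" for X
      using conj_mat_complexify[OF \<h>\<^sub>0(1)] that unfolding assms(5) .
    show "e \<beta> \<in> root_space \<h> \<beta> \<and> e \<beta> \<noteq> 0" if "\<beta> \<in> pos_roots \<h> Hs" for \<beta>
      using assms(10) that unfolding root_generators_def by blast
  qed (fact PQ assms(1) assms(9) assms(11) q_decomposition q_direct)+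
  obtain X Y H s t c k where "X \<in> \<q>" "Y \<in> \<q>" "H \<in> \<q>" "X \<noteq> 0"
    "bracket X Y = 0" "bracket X (conj_mat X) = 0"
    "bracket X (conj_mat Y) = s *\<^sub>m conj_mat X" "bracket Y (conj_mat X) = t *\<^sub>m X"
    "bracket Y (conj_mat Y) = c *\<^sub>m (H - conj_mat H)" "c \<noteq> 0"
    "bracket (conj_mat H) X = 0" "bracket H X = k *\<^sub>m X" "k \<noteq> 0"
    by (rule middle_relations)
  then have "\<not> pluriclosed J g" by (rule not_pluriclosed)
  with g(2) show False by contradiction
qed

end
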